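(* Let $T_d$ be the Chebyshev polynomial of degree $d\ge 2$ over $\mathbb{C}$. Then the action of the discrete iterated monodromy group $\mathrm{IMG}(T_d)$ on the space of paths of the $d$-ary tree of preimages is stable with discriminant group $\mathbb{Z}/2\mathbb{Z}$, the finite group of order $2$.
   Context: **Chebyshev polynomials.** $T_0(x)=1$, $T_1(x)=x$, $T_d(x)=2xT_{d-1}(x)-T_{d-2}(x)$; equivalently $T_d(\cos\theta)=\cos(d\theta)$. **Discrete iterated monodromy group.** Let $f$ be a polynomial of degree $d\ge2$ over $\mathbb{C}$, extended to $\mathbb{P}^1(\mathbb{C})$ by $f(\infty)=\infty$, whose post-critical set $P_C=\bigcup_{n\ge1}f^n(C)$ ($C$ the set of critical points in $\mathbb{P}^1(\mathbb{C})$) is finite; this holds for $T_d$. Let $\mathcal{M}=\mathbb{P}^1(\mathbb{C})\setminus P_C$, $\mathcal{M}_1=f^{-1}(\mathcal{M})\subset\mathcal{M}$; $f:\mathcal{M}_1\to\mathcal{M}$ is a $d$-to-$1$ covering. Fix $s\in\mathcal{M}$. The tree $\widetilde{T}$ has levels $V_n=f^{-n}(s)$ ($V_0=\{s\}$), with $\beta\in V_{n+1}$ joined to $f(\beta)\in V_n$; it is a rooted $d$-ary tree. $\pi_1(\mathcal{M},s)$ acts on each $V_n$ by path lifting, giving an action on $\widetilde T$ by automorphisms. $\mathrm{IMG}(f)=\pi_1(\mathcal{M},s)/\mathrm{Ker}$, where $\mathrm{Ker}$ consists of elements acting trivially on every $V_n$. $\mathrm{IMG}(f)$ acts on the path space of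 $\widetilde{T}$ (infinite paths from the root), a Cantor set, transitively on each level $V_n$. **Stable with discriminant group $D$.** Let $G$ be a countable group acting on a rooted $d$-ary tree transitively on each level. Fix a path $x=(v_n)_{n\ge0}$, let $G_n=\{g\in G\mid g\cdot v_n=v_n\}$ and, for $n\ge m\ge0$, $C^m_n=\bigcap_{g\in G_m}gG_ng^{-1}$. Put $\mathcal{D}^m_x=\varprojlim_{n\ge m}\{G_{n+1}/C^m_{n+1}\to G_n/C^m_n\}$ (maps induced by inclusions). For $k>m$ the inclusions $C^m_n\subset C^k_n$ induce surjective homomorphisms $\mathcal{D}^m_x\to\mathcal{D}^k_x$. The action is stable if there is $m_0$ such that these are isomorphisms for all $k>m\ge m_0$ (equivalently, the action on the path space of the closure of $G$ in the automorphism group of the tree is locally quasi-analytic), and it is stable with discriminant group $D$ if moreover $\mathcal{D}^k_x\cong D$ for all $k>m_0$. *)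

theory Defs
  imports
    "HOL-Analysis.Analysis"
    "HOL-Computational_Algebra.Computational_Algebra"
    "HOL-Algebra.Group_Action"
    "HOL-Algebra.Product_Groups"
    "HOL-Algebra.Elementary_Groups"
begin

section \<open>Actions on rooted trees and their discriminant groups\<close>

text \<open>
  A rooted tree is given by its levels \<open>V n\<close> and parent maps \<open>p n\<close> from \<open>V (Suc n)\<close> to \<open>V n\<close>.
  The vertices are the pairs \<open>(n, v)\<close> with \<open>v \<in> V n\<close>: the sets \<open>V n\<close> may overlap
  (for instance when \<open>V n\<close> consists of the \<open>n\<close>-th preimages of a periodic point).
\<close>

definition rooted_regular_tree ::
  "nat \<Rightarrow> (nat \<Rightarrow> 'v set) \<Rightarrow> (nat \<Rightarrow> 'v \<Rightarrow> 'v) \<Rightarrow> bool" where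
  "rooted_regular_tree d V p \<longleftrightarrow>
     card (V 0) = 1 \<and>
     (\<forall>n. \<forall>w\<in>V (Suc n). p n w \<in> V n) \<and>
     (\<forall>n. \<forall>v\<in>V n. card {w \<in> V (Suc n). p n w = v} = d)"

definition tree_paths :: "(nat \<Rightarrow> 'v set) \<Rightarrow> (nat \<Rightarrow> 'v \<Rightarrow> 'v) \<Rightarrow> (nat \<Rightarrow> 'v) set" where
  "tree_paths V p = {x. \<forall>n. x n \<in> V n \<and> p n (x (Suc n)) = x n}"

text \<open>\<open>\<phi> n g\<close> is the permutation of the level \<open>V n\<close> induced by \<open>g\<close>.\<close>

definition level_transitive_action ::
  "nat \<Rightarrow> ('g, 'b) monoid_scheme \<Rightarrow> (nat \<Rightarrow> 'v set) \<Rightarrow> (nat \<Rightarrow> 'v \<Rightarrow> 'v) \<Rightarrow> (nat \<Rightarrow> 'g \<Rightarrow> 'v \<Rightarrow> 'v) \<Rightarrow> bool" where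
  "level_transitive_action d G V p \<phi> \<longleftrightarrow>
     rooted_regular_tree d V p \<and>
     group G \<and> countable (carrier G) \<and>
     (\<forall>n. transitive_action G (V n) (\<phi> n)) \<and>
     (\<forall>n. \<forall>g\<in>carrier G. \<forall>w\<in>V (Suc n). p n (\<phi> (Suc n) g w) = \<phi> n g (p n w))"

definition path_stabilizer ::
  "('g, 'b) monoid_scheme \<Rightarrow> (nat \<Rightarrow> 'g \<Rightarrow> 'v \<Rightarrow> 'v) \<Rightarrow> (nat \<Rightarrow> 'v) \<Rightarrow> nat \<Rightarrow> 'g set" where
  "path_stabilizer G \<phi> x n = stabilizer G (\<phi> n) (x n)"

definition stabilizer_core ::
  "('g, 'b) monoid_scheme \<Rightarrow> (nat \<Rightarrow> 'g \<Rightarrow> 'v \<Rightarrow> 'v) \<Rightarrow> (nat \<Rightarrow> 'v) \<Rightarrow> nat \<Rightarrow> nat \<Rightarrow> 'g set" where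
  "stabilizer_core G \<phi> x m n =
     (\<Inter>g\<in>path_stabilizer G \<phi> x m. g <#\<^bsub>G\<^esub> path_stabilizer G \<phi> x n #>\<^bsub>G\<^esub> (inv\<^bsub>G\<^esub> g))"

definition stabilizer_quotient ::
  "('g, 'b) monoid_scheme \<Rightarrow> (nat \<Rightarrow> 'g \<Rightarrow> 'v \<Rightarrow> 'v) \<Rightarrow> (nat \<Rightarrow> 'v) \<Rightarrow> nat \<Rightarrow> nat \<Rightarrow> 'g set monoid" where
  "stabilizer_quotient G \<phi> x m n =
     (G\<lparr>carrier := path_stabilizer G \<phi> x n\<rparr>) Mod stabilizer_core G \<phi> x m n"

text \<open>
  For \<open>N \<subseteq> K\<close> the homomorphism of quotients induced by an inclusion sends the coset \<open>N g\<close> to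
  the coset \<open>K g = K (N g)\<close>, that is, it is \<open>A \<mapsto> K <#> A\<close>.
\<close>

definition discriminant_group ::
  "('g, 'b) monoid_scheme \<Rightarrow> (nat \<Rightarrow> 'g \<Rightarrow> 'v \<Rightarrow> 'v) \<Rightarrow> (nat \<Rightarrow> 'v) \<Rightarrow> nat \<Rightarrow> (nat \<Rightarrow> 'g set) monoid" where
  "discriminant_group G \<phi> x m =
     (product_group {m..} (stabilizer_quotient G \<phi> x m))
       \<lparr>carrier := {\<xi> \<in> carrier (product_group {m..} (stabilizer_quotient G \<phi> x m)).
          \<forall>n\<ge>m. stabilizer_core G \<phi> x m n <#>\<^bsub>G\<^esub> \<xi> (Suc n) = \<xi> n}\<rparr>"

definition discriminant_map ::
  "('g, 'b) monoid_scheme \<Rightarrow> (nat \<Rightarrow> 'g \<Rightarrow> 'v \<Rightarrow> 'v) \<Rightarrow> (nat \<Rightarrow> 'v) \<Rightarrow> nat \<Rightarrow> (nat \<Rightarrow> 'g set) \<Rightarrow> nat \<Rightarrow> 'g set" where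
  "discriminant_map G \<phi> x k \<xi> = (\<lambda>n\<in>{k..}. stabilizer_core G \<phi> x k n <#>\<^bsub>G\<^esub> \<xi> n)"

definition stable_with_discriminant ::
  "nat \<Rightarrow> ('g, 'b) monoid_scheme \<Rightarrow> (nat \<Rightarrow> 'v set) \<Rightarrow> (nat \<Rightarrow> 'v \<Rightarrow> 'v) \<Rightarrow> (nat \<Rightarrow> 'g \<Rightarrow> 'v \<Rightarrow> 'v) \<Rightarrow>
   (nat \<Rightarrow> 'v) \<Rightarrow> ('h, 'c) monoid_scheme \<Rightarrow> bool" where
  "stable_with_discriminant d G V p \<phi> x D \<longleftrightarrow>
     level_transitive_action d G V p \<phi> \<and> x \<in> tree_paths V p \<and>
     (\<exists>m\<^sub>0.
       (\<forall>m k. m\<^sub>0 \<le> m \<and> m < k \<longrightarrow>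
          discriminant_map G \<phi> x k \<in> iso (discriminant_group G \<phi> x m) (discriminant_group G \<phi> x k)) \<and>
       (\<forall>k>m\<^sub>0. discriminant_group G \<phi> x k \<cong> D))"


section \<open>The post-critical set of a polynomial\<close>

text \<open>
  The Riemann sphere is \<open>complex option\<close>, with \<open>None\<close> as the point at infinity. A nonconstant
  polynomial \<open>f\<close> acts on it by \<open>map_option (poly f)\<close>, so that infinity is fixed. Criticality of
  infinity is tested in the chart \<open>w = 1 / z\<close>.
\<close>

definition critical_points :: "complex poly \<Rightarrow> complex option set" where
  "critical_points f = {P. case P of
      Some z \<Rightarrow> poly (pderiv f) z = 0
    | None \<Rightarrow> ((\<lambda>w. if w = 0 then 0 else inverse (poly f (inverse w))) has_field_derivative 0) (at 0)}"

definition post_critical_set :: "complex poly \<Rightarrow> complex option set" where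
  "post_critical_set f = (\<Union>n\<in>{1..}. (map_option (poly f) ^^ n) ` critical_points f)"

text \<open>
  For \<open>degree f \<ge> 2\<close> infinity is post-critical, so the complement of the post-critical set in the
  sphere consists of finite points and is treated as a subset of \<open>complex\<close>.
\<close>

definition post_critical_complement :: "complex poly \<Rightarrow> complex set" where
  "post_critical_complement f = {z. Some z \<notin> post_critical_set f}"

lemma infinity_critical:
  assumes "degree f \<ge> 2"
  shows "None \<in> critical_points f"
proof -
  let ?d = "degree f" and ?r = "reflect_poly f"
  let ?h = "\<lambda>w. if w = 0 then 0 else inverse (poly f (inverse w))"
  from assms have "f \<noteq> 0"
    by auto
  then have "poly ?r 0 \<noteq> 0"
    by simp
  then have "((\<lambda>w. w ^ (?d - 1) / poly ?r w) \<longlongrightarrow> 0 ^ (?d - 1) / poly ?r 0) (at 0)"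
    by (intro tendsto_intros) auto
  moreover have "(0::complex) ^ (?d - 1) = 0"
    using assms by (simp add: power_0_left)
  moreover have "w ^ (?d - 1) / poly ?r w = (?h (0 + w) - ?h 0) / w" if "w \<noteq> 0" for w
  proof -
    have "w ^ ?d = w * w ^ (?d - 1)"
      using assms by (metis One_nat_def Suc_le_D Suc_pred numeral_2_eq_2 power_Suc zero_less_Suc)
    then show ?thesis
      using that by (simp add: poly_reflect_poly_nz divide_simps)
  qed
  ultimately have "((\<lambda>w. (?h (0 + w) - ?h 0) / w) \<longlongrightarrow> 0) (at 0)"
    by (smt (verit, best) Lim_cong_within div_0)
  then show ?thesis
    unfolding critical_points_def by (simp add: DERIV_def)
qed

lemma Some_image_post_critical_complement:
  assumes "degree f \<ge> 2"
  shows "Some ` post_critical_complement f = - post_critical_set f"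
proof -
  have "None \<in> (map_option (poly f) ^^ 1) ` critical_points f"
    using infinity_critical[OF assms] by force
  then have "None \<in> post_critical_set f"
    unfolding post_critical_set_def by blast
  then show ?thesis
    unfolding post_critical_complement_def by (auto simp: image_iff) (metis not_None_eq)
qed


section \<open>The fundamental group\<close>

definition loops_at :: "'a::topological_space set \<Rightarrow> 'a \<Rightarrow> (real \<Rightarrow> 'a) set" where
  "loops_at M s = {\<gamma>. path \<gamma> \<and> path_image \<gamma> \<subseteq> M \<and> pathstart \<gamma> = s \<and> pathfinish \<gamma> = s}"

text \<open>
  In the product of the classes of \<open>\<gamma>\<close> and \<open>\<delta>\<close> the loop \<open>\<delta>\<close> is traversed first; with this
  convention path lifting is a left action.
\<close>

definition fundamental_group :: "'a::topological_space set \<Rightarrow> 'a \<Rightarrow> (real \<Rightarrow> 'a) set monoid" where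
  "fundamental_group M s =
     \<lparr>carrier = loops_at M s // {(\<gamma>, \<delta>). \<gamma> \<in> loops_at M s \<and> homotopic_paths M \<gamma> \<delta>},
      monoid.mult = (\<lambda>A B. {\<rho>. \<exists>\<gamma>\<in>A. \<exists>\<delta>\<in>B. homotopic_paths M (\<delta> +++ \<gamma>) \<rho>}),
      one = {\<rho>. homotopic_paths M (\<lambda>_. s) \<rho>}\<rparr>"


section \<open>Discrete iterated monodromy groups\<close>

abbreviation monodromy_base_group :: "complex poly \<Rightarrow> complex \<Rightarrow> (real \<Rightarrow> complex) set monoid" where
  "monodromy_base_group f s \<equiv> fundamental_group (post_critical_complement f) s"

definition preimage_level :: "complex poly \<Rightarrow> complex \<Rightarrow> nat \<Rightarrow> complex set" where
  "preimage_level f s n = {\<beta>. (poly f ^^ n) \<beta> = s}"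

text \<open>The parent of \<open>\<beta>\<close> in level \<open>Suc n\<close> is \<open>f \<beta>\<close> in level \<open>n\<close>.\<close>

definition preimage_parent :: "complex poly \<Rightarrow> nat \<Rightarrow> complex \<Rightarrow> complex" where
  "preimage_parent f n = poly f"

text \<open>
  The class \<open>A\<close> sends \<open>\<beta>\<close> to the endpoint of the lift under the \<open>n\<close>-th iterate of \<open>f\<close>, starting
  at \<open>\<beta>\<close>, of a loop in \<open>A\<close>.
\<close>

definition monodromy_action ::
  "complex poly \<Rightarrow> complex \<Rightarrow> nat \<Rightarrow> (real \<Rightarrow> complex) set \<Rightarrow> complex \<Rightarrow> complex" where
  "monodromy_action f s n A =
     (\<lambda>\<beta>\<in>preimage_level f s n. THE w. \<exists>\<gamma>\<in>A. \<exists>\<eta>. path \<eta> \<and> pathstart \<eta> = \<beta> \<and> pathfinish \<eta> = w \<and>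
        (\<forall>t\<in>{0..1}. (poly f ^^ n) (\<eta> t) = \<gamma> t))"

definition monodromy_kernel :: "complex poly \<Rightarrow> complex \<Rightarrow> (real \<Rightarrow> complex) set set" where
  "monodromy_kernel f s = {A \<in> carrier (monodromy_base_group f s).
     \<forall>n. \<forall>\<beta>\<in>preimage_level f s n. monodromy_action f s n A \<beta> = \<beta>}"

definition IMG :: "complex poly \<Rightarrow> complex \<Rightarrow> (real \<Rightarrow> complex) set set monoid" where
  "IMG f s = monodromy_base_group f s Mod monodromy_kernel f s"

definition IMG_action ::
  "complex poly \<Rightarrow> complex \<Rightarrow> nat \<Rightarrow> (real \<Rightarrow> complex) set set \<Rightarrow> complex \<Rightarrow> complex" where
  "IMG_action f s n X = the_elem (monodromy_action f s n ` X)"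


section \<open>Chebyshev polynomials\<close>

fun chebyshev_poly :: "nat \<Rightarrow> 'a::comm_ring_1 poly" where
  "chebyshev_poly 0 = 1"
| "chebyshev_poly (Suc 0) = [:0, 1:]"
| "chebyshev_poly (Suc (Suc n)) = [:0, 2:] * chebyshev_poly (Suc n) - chebyshev_poly n"

end

theory Submission
  imports Defs
begin

text \<open>
  Write \<open>s = cos \<theta>\<close>. The identity \<open>T\<^sub>d (cos z) = cos (d z)\<close> linearises the dynamics. Its post-critical
  set is \<open>{1, -1, \<infinity>}\<close>, and \<open>cos\<close> maps the plane without the zeros of \<open>sin\<close> onto the plane without
  \<open>1\<close> and \<open>-1\<close> as a covering (\<open>covering_space_cos\<close>). The vertices of level \<open>n\<close> are the points
  \<open>cos ((\<theta> + 2\<pi>k) / d^n)\<close>, one for each residue \<open>k\<close> modulo \<open>d^n\<close>, and a lift of a loop under the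
  \<open>n\<close>-th iterate of \<open>T\<^sub>d\<close> is \<open>cos (\<zeta> / d^n)\<close> for a lift \<open>\<zeta>\<close> of the loop through the single map
  \<open>cos\<close>. So one covering governs all the levels at once.

  The lift \<open>\<zeta>\<close> of a loop at \<open>s\<close> that starts at \<open>\<theta> + 2\<pi>k\<close> ends at a point with cosine \<open>s\<close>, that is,
  at \<open>\<plusminus>(\<theta> + 2\<pi>l)\<close>. By the symmetries \<open>z \<mapsto> \<plusminus>z + 2\<pi>i\<close> of \<open>cos\<close> the dependence is
  \<open>l = e k + j\<close> with \<open>e = \<plusminus>1\<close> and \<open>j\<close> depending only on the homotopy class of the loop. All these
  maps occur, since the plane without the zeros of \<open>sin\<close> is path connected, and such a map is
  the identity as soon as it is the identity modulo every \<open>d^n\<close>. Hence the iterated monodromy group is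
  the infinite dihedral group of the maps \<open>k \<mapsto> e k + j\<close>, acting on the residues modulo \<open>d^n\<close>
  (\<open>deck_map_hom\<close>, \<open>monodromy_kernel_chebyshev\<close>, \<open>dihedral_tree_action_IMG_chebyshev\<close>).

  What remains is a computation in this group. Let the path have the vertex with label \<open>a\<^sub>n\<close> on level
  \<open>n\<close>. Its stabilizer \<open>G\<^sub>n\<close> consists of the translations by multiples of \<open>d^n\<close> and of the reflections
  \<open>k \<mapsto> j - k\<close> with \<open>j\<close> congruent to \<open>2a\<^sub>n\<close> modulo \<open>d^n\<close>. These translations form a normal subgroup
  of the whole group, so they lie in every core. A reflection in \<open>G\<^sub>n\<close>, conjugated by the translation
  by \<open>d^m\<close>, moves \<open>a\<^sub>n\<close> by \<open>-2d^m\<close>, which is not a multiple of \<open>d^n\<close> when \<open>n \<ge> m + 2\<close>. Therefore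
  \<open>G\<^sub>n / C\<^sup>m\<^sub>n\<close> has order two for \<open>n \<ge> m + 2\<close>, generated by the class of the involution
  \<open>k \<mapsto> 2a\<^sub>n - k\<close>. Consecutive involutions differ by an element of the core, so their classes form an
  element of the inverse limit. It generates the limit, and the maps between the limits for different
  \<open>m\<close> carry generator to generator. Thus the action is stable already from level \<open>0\<close> on.
\<close>


section \<open>Discriminant groups generated by coherent involutions\<close>

lemma (in group) inv_mult_cancel:
  assumes "g \<in> carrier G" and "y \<in> carrier G"
  shows "inv g \<otimes> (g \<otimes> y) = y" and "g \<otimes> (inv g \<otimes> y) = y"
  using assms by (simp_all add: m_assoc[symmetric])

text \<open>
  The transition maps of the inverse systems are all of the form \<open>A \<mapsto> K <#> A\<close>; on a coset of a
  smaller subgroup they just enlarge the subgroup.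
\<close>

lemma (in group) set_mult_r_coset_absorb:
  assumes K: "subgroup K G" and N: "\<one> \<in> N" "N \<subseteq> K" and a: "a \<in> carrier G"
  shows "K <#> (N #> a) = K #> a"
proof
  show "K <#> (N #> a) \<subseteq> K #> a"
  proof
    fix y assume "y \<in> K <#> (N #> a)"
    then obtain k n where k: "k \<in> K" "n \<in> N" "y = k \<otimes> (n \<otimes> a)"
      unfolding set_mult_def r_coset_def by blast
    then have "y = (k \<otimes> n) \<otimes> a" "k \<otimes> n \<in> K"
      using a N subgroup.mem_carrier[OF K] subgroup.m_closed[OF K] by (auto simp: m_assoc subset_iff)
    then show "y \<in> K #> a"
      unfolding r_coset_def by blast
  qed
  show "K #> a \<subseteq> K <#> (N #> a)"
  proof
    fix y assume "y \<in> K #> a"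
    then obtain k where "k \<in> K" "y = k \<otimes> (\<one> \<otimes> a)"
      using a unfolding r_coset_def by auto
    then show "y \<in> K <#> (N #> a)"
      using N unfolding set_mult_def r_coset_def by blast
  qed
qed

text \<open>
  Only two properties of the tree enter the definition of the discriminant groups: the stabilizers
  of the vertices of a path are subgroups, and they decrease along the path.
\<close>

locale stabilizer_chain = group G for G (structure) +
  fixes \<phi> :: "nat \<Rightarrow> 'a \<Rightarrow> 'v \<Rightarrow> 'v" and x :: "nat \<Rightarrow> 'v"
  assumes stabilizer_subgroup: "subgroup (path_stabilizer G \<phi> x n) G"
    and stabilizer_Suc: "path_stabilizer G \<phi> x (Suc n) \<subseteq> path_stabilizer G \<phi> x n"
begin

abbreviation stab :: "nat \<Rightarrow> 'a set" where
  "stab \<equiv> path_stabilizer G \<phi> x"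

abbreviation core :: "nat \<Rightarrow> nat \<Rightarrow> 'a set" where
  "core \<equiv> stabilizer_core G \<phi> x"

lemma stab_mono: "m \<le> n \<Longrightarrow> stab n \<subseteq> stab m"
  using stabilizer_Suc by (rule lift_Suc_antimono_le)

lemma stab_closed: "g \<in> stab n \<Longrightarrow> g \<in> carrier G"
  using stabilizer_subgroup subgroup.mem_carrier by metis

lemma mem_core_iff: "z \<in> core m n \<longleftrightarrow> z \<in> carrier G \<and> (\<forall>g\<in>stab m. inv g \<otimes> z \<otimes> g \<in> stab n)"
proof -
  have "z \<in> g <# stab n #> inv g \<longleftrightarrow> z \<in> carrier G \<and> inv g \<otimes> z \<otimes> g \<in> stab n" if g: "g \<in> stab m" for g
  proof
    assume "z \<in> g <# stab n #> inv g"
    then obtain y where "y \<in> stab n" "z = g \<otimes> y \<otimes> inv g"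
      unfolding l_coset_def r_coset_def by blast
    then show "z \<in> carrier G \<and> inv g \<otimes> z \<otimes> g \<in> stab n"
      using stab_closed g by (simp add: m_assoc inv_mult_cancel)
  next
    assume z: "z \<in> carrier G \<and> inv g \<otimes> z \<otimes> g \<in> stab n"
    then have "z = g \<otimes> (inv g \<otimes> z \<otimes> g) \<otimes> inv g"
      using stab_closed[OF g] by (simp add: m_assoc inv_mult_cancel)
    then show "z \<in> g <# stab n #> inv g"
      using z unfolding l_coset_def r_coset_def by blast
  qed
  moreover have "\<one> \<in> stab m"
    using stabilizer_subgroup by (rule subgroup.one_closed)
  ultimately show ?thesis
    unfolding stabilizer_core_def by blast
qed

lemma core_subset: "core m n \<subseteq> stab n"
proof
  fix z assume z: "z \<in> core m n"
  have "\<one> \<in> stab m"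
    using stabilizer_subgroup by (rule subgroup.one_closed)
  then show "z \<in> stab n"
    using z unfolding mem_core_iff by force
qed

lemma core_mono:
  assumes "m \<le> m'" and "n' \<le> n"
  shows "core m n \<subseteq> core m' n'"
  using stab_mono[OF assms(1)] stab_mono[OF assms(2)] unfolding mem_core_iff subset_iff by blast

lemma core_subgroup: "subgroup (core m n) G"
proof (rule subgroupI)
  have sub: "subgroup (stab n) G" and one: "\<one> \<in> stab n"
    using stabilizer_subgroup subgroup.one_closed by auto
  show "core m n \<subseteq> carrier G"
    by (auto simp: mem_core_iff)
  have "\<one> \<in> core m n"
    using one stab_closed by (simp add: mem_core_iff)
  then show "core m n \<noteq> {}"
    by blast
  show "inv z \<in> core m n" if "z \<in> core m n" for z
    unfolding mem_core_iff
  proof (intro conjI ballI)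
    show "inv z \<in> carrier G"
      using that by (simp add: mem_core_iff)
    fix g assume g: "g \<in> stab m"
    have "inv (inv g \<otimes> z \<otimes> g) \<in> stab n"
      using that g subgroup.m_inv_closed[OF sub] by (auto simp: mem_core_iff)
    then show "inv g \<otimes> inv z \<otimes> g \<in> stab n"
      using that stab_closed[OF g] by (simp add: mem_core_iff inv_mult_group m_assoc)
  qed
  show "y \<otimes> z \<in> core m n" if "y \<in> core m n" "z \<in> core m n" for y z
    unfolding mem_core_iff
  proof (intro conjI ballI)
    show "y \<otimes> z \<in> carrier G"
      using that by (simp add: mem_core_iff)
    fix g assume g: "g \<in> stab m"
    have "(inv g \<otimes> y \<otimes> g) \<otimes> (inv g \<otimes> z \<otimes> g) \<in> stab n"
      using that g subgroup.m_closed[OF sub] by (auto simp: mem_core_iff)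
    moreover have "(inv g \<otimes> y \<otimes> g) \<otimes> (inv g \<otimes> z \<otimes> g) = inv g \<otimes> (y \<otimes> z) \<otimes> g"
      using that stab_closed[OF g] by (simp add: mem_core_iff m_assoc inv_mult_cancel)
    ultimately show "inv g \<otimes> (y \<otimes> z) \<otimes> g \<in> stab n"
      by simp
  qed
qed

text \<open>
  Conjugation by an element of \<open>G\<^sub>n\<close> permutes the conjugates of \<open>G\<^sub>n\<close> by elements of \<open>G\<^sub>m\<close>, because
  \<open>G\<^sub>n \<subseteq> G\<^sub>m\<close>. This is where \<open>m \<le> n\<close> is essential.
\<close>

lemma core_normal:
  assumes "m \<le> n"
  shows "core m n \<lhd> G\<lparr>carrier := stab n\<rparr>"
proof -
  interpret S: group "G\<lparr>carrier := stab n\<rparr>"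
    using stabilizer_subgroup by (rule subgroup_imp_group)
  have "subgroup (core m n) (G\<lparr>carrier := stab n\<rparr>)"
    using core_subgroup core_subset stabilizer_subgroup subgroup_incl by blast
  moreover have "y \<otimes> z \<otimes> inv y \<in> core m n" if y: "y \<in> stab n" and z: "z \<in> core m n" for y z
    unfolding mem_core_iff
  proof (intro conjI ballI)
    have closed: "y \<in> carrier G" "z \<in> carrier G"
      using y z stab_closed by (auto simp: mem_core_iff)
    then show "y \<otimes> z \<otimes> inv y \<in> carrier G"
      by simp
    fix g assume g: "g \<in> stab m"
    have "inv y \<otimes> g \<in> stab m"
      using y g stab_mono[OF assms] stabilizer_subgroup
      by (meson subgroup.m_closed subgroup.m_inv_closed subsetD)
    then have "inv (inv y \<otimes> g) \<otimes> z \<otimes> (inv y \<otimes> g) \<in> stab n"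
      using z by (simp add: mem_core_iff)
    then show "inv g \<otimes> (y \<otimes> z \<otimes> inv y) \<otimes> g \<in> stab n"
      using closed stab_closed[OF g] by (simp add: inv_mult_group m_assoc)
  qed
  ultimately show ?thesis
    using m_inv_consistent[OF stabilizer_subgroup] by (simp add: S.normal_inv_iff)
qed

end

text \<open>
  A criterion for all the discriminant groups to have order two: every stabilizer contains an
  involution \<open>\<rho> n\<close>, consecutive involutions agree modulo the cores, and far enough from level \<open>m\<close>
  the involution represents the only nontrivial class of \<open>G\<^sub>n\<close> modulo the core. The classes of the \<open>\<rho> n\<close>
  then form the nontrivial element of the inverse limit. The distance \<open>2\<close> is what the dihedral
  actions below require: with branching \<open>2\<close> the quotient at distance \<open>1\<close> is still trivial.
\<close>

locale coherent_involutions = stabilizer_chain +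
  fixes \<rho> :: "nat \<Rightarrow> 'a"
  assumes involution_closed: "\<rho> n \<in> stab n"
    and involution_square: "\<rho> n \<otimes> \<rho> n = \<one>"
    and involution_coherent: "m \<le> n \<Longrightarrow> \<rho> (Suc n) \<otimes> inv \<rho> n \<in> core m n"
    and stab_cover: "m + 2 \<le> n \<Longrightarrow> stab n \<subseteq> core m n \<union> (core m n #> \<rho> n)"
    and involution_notin_core: "m + 2 \<le> n \<Longrightarrow> \<rho> n \<notin> core m n"
begin

text \<open>
  The power of \<open>\<rho> n\<close> with exponent in \<open>integer_mod_group 2\<close>, whose carrier consists of the integers
  \<open>0\<close> and \<open>1\<close>.
\<close>

definition involution_power :: "nat \<Rightarrow> int \<Rightarrow> 'a" where
  "involution_power n i = (if i = 0 then \<one> else \<rho> n)"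

definition involution_thread :: "nat \<Rightarrow> int \<Rightarrow> nat \<Rightarrow> 'a set" where
  "involution_thread m i = (\<lambda>n\<in>{m..}. core m n #> involution_power n i)"

lemma involution_power_closed: "involution_power n i \<in> stab n" "involution_power n i \<in> carrier G"
  using involution_closed subgroup.one_closed[OF stabilizer_subgroup] stab_closed
  by (auto simp: involution_power_def)

text \<open>
  With \<open>k = m\<close> this is the compatibility that makes the classes of the involutions an element of the
  inverse limit.
\<close>

lemma core_coset_Suc:
  assumes "m \<le> k" and "k \<le> n"
  shows "core k n <#> (core m (Suc n) #> involution_power (Suc n) i) = core k n #> involution_power n i"
proof -
  have "core k n <#> (core m (Suc n) #> involution_power (Suc n) i) = core k n #> involution_power (Suc n) i"
    using core_mono[OF assms(1), of n "Suc n"] subgroup.one_closed[OF core_subgroup]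
    by (intro set_mult_r_coset_absorb core_subgroup involution_power_closed) auto
  also have "\<dots> = core k n #> involution_power n i"
  proof (cases "i = 0")
    case False
    have "\<rho> (Suc n) = \<rho> (Suc n) \<otimes> inv \<rho> n \<otimes> \<rho> n"
      using stab_closed[OF involution_closed, of n] stab_closed[OF involution_closed, of "Suc n"]
      by (simp add: m_assoc)
    then have "\<rho> (Suc n) \<in> core k n #> \<rho> n"
      using involution_coherent[OF assms(2)] unfolding r_coset_def by blast
    then show ?thesis
      using False repr_independence[OF _ _ core_subgroup] stab_closed[OF involution_closed]
      by (simp add: involution_power_def)
  qed (simp add: involution_power_def)
  finally show ?thesis .
qed

lemma core_coset_power_inj:
  assumes "m + 2 \<le> n" and "i \<in> {0, 1}" and "j \<in> {0, 1}"
    and "core m n #> involution_power n i = core m n #> involution_power n j"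
  shows "i = j"
proof -
  have "core m n #> \<rho> n \<noteq> core m n #> \<one>"
    using involution_notin_core[OF assms(1)] rcos_self[OF stab_closed[OF involution_closed] core_subgroup]
      coset_mult_one[OF subgroup.subset[OF core_subgroup]] by metis
  then show ?thesis
    using assms(2-4) by (auto simp: involution_power_def)
qed

lemma carrier_discriminant_group:
  "\<xi> \<in> carrier (discriminant_group G \<phi> x m) \<longleftrightarrow>
     \<xi> \<in> extensional {m..} \<and> (\<forall>n\<ge>m. \<exists>g\<in>stab n. \<xi> n = core m n #> g) \<and>
     (\<forall>n\<ge>m. core m n <#> \<xi> (Suc n) = \<xi> n)"
  by (auto simp: discriminant_group_def stabilizer_quotient_def FactGroup_def RCOSETS_def r_coset_def
      PiE_def Pi_def)

text \<open>
  An element of the inverse limit agrees with a power of the involution on each level \<open>n \<ge> m + 2\<close>.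
  The transition maps propagate this power to all lower levels, and the power is determined on level
  \<open>m + 2\<close>, so it is the same for all \<open>n\<close>.
\<close>

lemma involution_thread_iso:
  "involution_thread m \<in> iso (integer_mod_group 2) (discriminant_group G \<phi> x m)"
proof -
  have carrier2: "carrier (integer_mod_group 2) = {0, 1}"
    by (auto simp: carrier_integer_mod_group)
  have closed: "involution_thread m i \<in> carrier (discriminant_group G \<phi> x m)" for i
    unfolding carrier_discriminant_group involution_thread_def
    using involution_power_closed(1) core_coset_Suc[OF order_refl] by auto
  have mult: "involution_thread m ((i + j) mod 2) =
      involution_thread m i \<otimes>\<^bsub>discriminant_group G \<phi> x m\<^esub> involution_thread m j"
    if "i \<in> {0, 1}" "j \<in> {0, 1}" for i j
  proof -
    have "(core m n #> involution_power n i) <#> (core m n #> involution_power n j) =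
        core m n #> involution_power n ((i + j) mod 2)" if n: "m \<le> n" for n
    proof -
      have "(core m n #> involution_power n i) <#> (core m n #> involution_power n j) =
          core m n #> (involution_power n i \<otimes> involution_power n j)"
        using normal.rcos_sum[OF core_normal[OF n], of "involution_power n i" "involution_power n j"]
          involution_power_closed by (simp add: r_coset_def set_mult_def)
      also have "involution_power n i \<otimes> involution_power n j = involution_power n ((i + j) mod 2)"
        using \<open>i \<in> {0, 1}\<close> \<open>j \<in> {0, 1}\<close> involution_square stab_closed[OF involution_closed]
        by (auto simp: involution_power_def)
      finally show ?thesis .
    qed
    moreover have "A <#>\<^bsub>G\<lparr>carrier := S\<rparr>\<^esub> B = A <#> B" for A B S
      by (simp add: set_mult_def)
    ultimately show ?thesis
      by (auto simp: discriminant_group_def product_group_def stabilizer_quotient_def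
          involution_thread_def intro!: restrict_ext)
  qed
  have inj: "inj_on (involution_thread m) {0, 1}"
  proof (rule inj_onI)
    fix i j :: int
    assume ij: "i \<in> {0, 1}" "j \<in> {0, 1}" "involution_thread m i = involution_thread m j"
    from fun_cong[OF ij(3), of "m + 2"] show "i = j"
      using core_coset_power_inj[OF order_refl ij(1,2)] by (simp add: involution_thread_def)
  qed
  have surj: "\<xi> \<in> involution_thread m ` {0, 1}" if \<xi>: "\<xi> \<in> carrier (discriminant_group G \<phi> x m)" for \<xi>
  proof -
    have ext: "\<xi> \<in> extensional {m..}"
      and coset: "\<And>n. m \<le> n \<Longrightarrow> \<exists>g\<in>stab n. \<xi> n = core m n #> g"
      and thread: "\<And>n. m \<le> n \<Longrightarrow> core m n <#> \<xi> (Suc n) = \<xi> n"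
      using \<xi> unfolding carrier_discriminant_group by auto
    have power: "\<exists>i\<in>{0, 1}. \<xi> n = core m n #> involution_power n i" if n: "m + 2 \<le> n" for n
    proof -
      obtain g where g: "g \<in> stab n" "\<xi> n = core m n #> g"
        using coset[of n] n by auto
      from stab_cover[OF n] g(1) consider "g \<in> core m n" | "g \<in> core m n #> \<rho> n"
        by blast
      then show ?thesis
      proof cases
        case 1
        then have "core m n #> g = core m n #> \<one>"
          using stab_closed[OF g(1)] core_subgroup coset_join2 coset_mult_one subgroup.subset by metis
        then show ?thesis
          using g(2) by (intro bexI[of _ 0]) (auto simp: involution_power_def)
      next
        case 2
        then have "core m n #> g = core m n #> \<rho> n"
          using repr_independence[OF 2 stab_closed[OF involution_closed] core_subgroup] by simp
        then show ?thesis
          using g(2) by (intro bexI[of _ 1]) (auto simp: involution_power_def)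
      qed
    qed
    have descend: "\<xi> n = core m n #> involution_power n i"
      if "\<xi> N = core m N #> involution_power N i" "m \<le> n" "n \<le> N" for n N i
      using that(3,2,1)
    proof (induction n rule: inc_induct)
      case (step n)
      then show ?case
        using thread[of n] core_coset_Suc[of m m n i] by simp
    qed
    obtain i where i: "i \<in> {0, 1}" "\<xi> (m + 2) = core m (m + 2) #> involution_power (m + 2) i"
      using power by blast
    have "\<xi> n = core m n #> involution_power n i" if n: "m \<le> n" for n
    proof -
      obtain j where j: "j \<in> {0, 1}" "\<xi> (max n (m + 2)) = core m (max n (m + 2)) #> involution_power (max n (m + 2)) j"
        using power[of "max n (m + 2)"] by auto
      have "\<xi> n = core m n #> involution_power n j"
        "\<xi> (m + 2) = core m (m + 2) #> involution_power (m + 2) j"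
        using n by (intro descend[OF j(2)]; simp)+
      with i j(1) show ?thesis
        using core_coset_power_inj[of m "m + 2" i j] by simp
    qed
    then have "\<xi> = involution_thread m i"
      using ext by (intro HOL.ext) (auto simp: involution_thread_def extensional_def)
    with i(1) show ?thesis
      by blast
  qed
  have "involution_thread m \<in> hom (integer_mod_group 2) (discriminant_group G \<phi> x m)"
    using closed mult by (intro homI) (simp_all add: carrier2)
  moreover have "bij_betw (involution_thread m) (carrier (integer_mod_group 2)) (carrier (discriminant_group G \<phi> x m))"
    unfolding carrier2 bij_betw_def using inj surj closed by blast
  ultimately show ?thesis
    by (rule isoI)
qed

lemma discriminant_map_involution_thread:
  assumes "m \<le> k"
  shows "discriminant_map G \<phi> x k (involution_thread m i) = involution_thread k i"
  unfolding discriminant_map_def involution_thread_def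
proof (rule restrict_ext)
  fix n assume "n \<in> {k..}"
  moreover have "core k n <#> (core m n #> involution_power n i) = core k n #> involution_power n i"
    using core_mono[OF assms, of n n] subgroup.one_closed[OF core_subgroup]
    by (intro set_mult_r_coset_absorb core_subgroup involution_power_closed) auto
  ultimately show "core k n <#> (\<lambda>n\<in>{m..}. core m n #> involution_power n i) n = core k n #> involution_power n i"
    using assms by simp
qed

text \<open>
  On the explicit elements the map of inverse limits carries the generator to the generator, so it is
  a composition of the isomorphisms with \<open>integer_mod_group 2\<close>.
\<close>

theorem discriminant_map_iso:
  assumes "m \<le> k"
  shows "discriminant_map G \<phi> x k \<in> iso (discriminant_group G \<phi> x m) (discriminant_group G \<phi> x k)"
proof -
  let ?Z = "integer_mod_group 2" and ?D = "discriminant_group G \<phi> x"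
  let ?inv = "inv_into (carrier ?Z) (involution_thread m)"
  have inv: "?inv \<in> iso (?D m) ?Z"
    by (intro group.iso_set_sym group_integer_mod_group involution_thread_iso)
  have comp: "involution_thread k \<circ> ?inv \<in> iso (?D m) (?D k)"
    by (rule iso_set_trans[OF inv involution_thread_iso])
  have eq: "discriminant_map G \<phi> x k \<xi> = (involution_thread k \<circ> ?inv) \<xi>" if "\<xi> \<in> carrier (?D m)" for \<xi>
  proof -
    have "\<xi> \<in> involution_thread m ` carrier ?Z"
      using that involution_thread_iso[of m] by (simp add: iso_def bij_betw_def)
    then have "\<xi> = involution_thread m (?inv \<xi>)"
      by (simp add: f_inv_into_f)
    then show ?thesis
      using discriminant_map_involution_thread[OF assms] by (metis comp_apply)
  qed
  have "\<xi> \<otimes>\<^bsub>?D m\<^esub> \<eta> \<in> carrier (?D m)" if "\<xi> \<in> carrier (?D m)" "\<eta> \<in> carrier (?D m)" for \<xi> \<eta>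
  proof -
    have "\<xi> \<in> involution_thread m ` carrier ?Z" "\<eta> \<in> involution_thread m ` carrier ?Z"
      using that involution_thread_iso[of m] by (simp_all add: iso_def bij_betw_def)
    then obtain i j where ij: "i \<in> carrier ?Z" "j \<in> carrier ?Z" "\<xi> = involution_thread m i" "\<eta> = involution_thread m j"
      by blast
    have hom: "involution_thread m \<in> hom ?Z (?D m)"
      using involution_thread_iso by (simp add: iso_def)
    show ?thesis
      unfolding ij(3,4) hom_mult[OF hom ij(1,2), symmetric]
      by (intro hom_in_carrier[OF hom] monoid.m_closed group.is_monoid group_integer_mod_group ij)
  qed
  then show ?thesis
    using comp eq unfolding iso_def hom_def by (auto cong: bij_betw_cong)
qed

end


section \<open>Dihedral actions on regular trees\<close>

text \<open>
  The infinite dihedral group, as the isometries of the integers.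
\<close>

definition dihedral_maps :: "(int \<Rightarrow> int) set" where
  "dihedral_maps = {\<lambda>k. e * k + j | e j. e \<in> {1, -1}}"

lemma dihedral_mapsE:
  assumes "f \<in> dihedral_maps"
  obtains e j where "e \<in> {1, -1}" and "f = (\<lambda>k. e * k + j)"
  using assms unfolding dihedral_maps_def by blast

lemma countable_dihedral_maps: "countable dihedral_maps"
proof -
  have "dihedral_maps = (\<lambda>(e, j) k. e * k + j) ` ({1, -1} \<times> UNIV)"
    unfolding dihedral_maps_def by (auto simp: image_iff)
  moreover have "countable ((\<lambda>(e, j) k. e * k + j) ` ({1, -1} \<times> (UNIV :: int set)) :: (int \<Rightarrow> int) set)"
    by (intro countable_image countableI_type)
  ultimately show ?thesis
    by (rule ssubst)
qed

text \<open>
  The vertices of level \<open>n\<close> are labelled by the residues modulo \<open>d^n\<close> in such a way that passing to the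
  parent is reduction modulo \<open>d^n\<close>, and the group acts through its faithful dihedral action \<open>h\<close> on the
  integers, which determines the action \<open>\<phi>\<close> on every level.
\<close>

locale dihedral_tree_action = group G for G (structure) +
  fixes d :: nat and V :: "nat \<Rightarrow> 'v set" and p :: "nat \<Rightarrow> 'v \<Rightarrow> 'v"
    and \<phi> :: "nat \<Rightarrow> 'a \<Rightarrow> 'v \<Rightarrow> 'v" and v :: "nat \<Rightarrow> int \<Rightarrow> 'v" and h :: "'a \<Rightarrow> int \<Rightarrow> int"
  assumes degree: "d \<ge> 2"
    and h_inj: "inj_on h (carrier G)"
    and h_image: "h ` carrier G = dihedral_maps"
    and h_mult: "\<lbrakk>g \<in> carrier G; g' \<in> carrier G\<rbrakk> \<Longrightarrow> h (g \<otimes> g') = h g \<circ> h g'"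
    and level: "V n = range (v n)"
    and vertex_eq_iff: "v n k = v n l \<longleftrightarrow> int (d ^ n) dvd k - l"
    and parent: "p n (v (Suc n) k) = v n k"
    and action: "g \<in> carrier G \<Longrightarrow> \<phi> n g (v n k) = v n (h g k)"
    and action_extensional: "g \<in> carrier G \<Longrightarrow> \<phi> n g \<in> extensional (V n)"
begin

lemma h_affine:
  assumes "g \<in> carrier G"
  obtains e j where "e \<in> {1, -1}" and "h g = (\<lambda>k. e * k + j)"
  using assms h_image dihedral_mapsE by (metis imageI)

lemma h_bij: assumes "g \<in> carrier G" shows "bij (h g)"
proof -
  obtain e j where "e \<in> {1, -1}" "h g = (\<lambda>k. e * k + j)"
    using assms by (rule h_affine)
  then show ?thesis
    by (intro o_bij[of "\<lambda>k. e * (k - j)"]) (auto simp: o_def)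
qed

lemma h_one: "h \<one> = id"
proof
  fix k
  have "h \<one> (h \<one> k) = h \<one> k"
    using h_mult[of \<one> \<one>] by (metis comp_apply l_one one_closed)
  then show "h \<one> k = id k"
    using bij_is_inj[OF h_bij[OF one_closed]] by (simp add: inj_eq)
qed

lemma h_inv: "g \<in> carrier G \<Longrightarrow> h (inv g) (h g k) = k"
  using h_mult[of "inv g" g] h_one by (metis comp_apply id_apply inv_closed l_inv)

lemma h_congruent:
  assumes "g \<in> carrier G"
  shows "m dvd h g k - h g l \<longleftrightarrow> m dvd k - l"
proof -
  obtain e j where e: "e \<in> {1, -1}" "h g = (\<lambda>k. e * k + j)"
    using assms by (rule h_affine)
  have "h g k - h g l = e * (k - l)"
    unfolding e(2) by (simp add: algebra_simps)
  then show ?thesis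
    using e(1) dvd_minus_iff[of m "k - l"] by auto
qed

text \<open>
  The residues modulo \<open>d^(n+1)\<close> above \<open>k\<close> are \<open>k + d^n i\<close> with \<open>0 \<le> i < d\<close>.
\<close>

lemma parent_fibre: "card {w \<in> V (Suc n). p n w = v n k} = d"
proof -
  let ?w = "\<lambda>i. v (Suc n) (k + int (d ^ n) * i)"
  have d0: "int (d ^ n) \<noteq> 0"
    using degree by simp
  have "{w \<in> V (Suc n). p n w = v n k} = ?w ` {0..<int d}"
  proof
    show "?w ` {0..<int d} \<subseteq> {w \<in> V (Suc n). p n w = v n k}"
      by (auto simp: level parent vertex_eq_iff)
    show "{w \<in> V (Suc n). p n w = v n k} \<subseteq> ?w ` {0..<int d}"
    proof
      fix w assume "w \<in> {w \<in> V (Suc n). p n w = v n k}"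
      then obtain l where w: "w = v (Suc n) l" and "v n l = v n k"
        unfolding level using parent by auto
      then obtain i where i: "l - k = int (d ^ n) * i"
        unfolding vertex_eq_iff by (elim dvdE)
      have "l - (k + int (d ^ n) * (i mod int d)) = int (d ^ n) * (i - i mod int d)"
        using i by (simp add: algebra_simps)
      also have "i - i mod int d = int d * (i div int d)"
        by (simp add: minus_mod_eq_mult_div)
      finally have "w = ?w (i mod int d)"
        unfolding w vertex_eq_iff by simp
      moreover have "i mod int d \<in> {0..<int d}"
        using degree by simp
      ultimately show "w \<in> ?w ` {0..<int d}"
        by blast
    qed
  qed
  moreover have "inj_on ?w {0..<int d}"
  proof (rule inj_onI)
    fix i j assume ij: "i \<in> {0..<int d}" "j \<in> {0..<int d}" "?w i = ?w j"
    then have "int (d ^ n) * int d dvd int (d ^ n) * (i - j)"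
      unfolding vertex_eq_iff by (simp add: algebra_simps)
    then have "int d dvd i - j"
      using d0 by (simp only: dvd_mult_cancel_left simp_thms)
    then have "i mod int d = j mod int d"
      by (simp only: mod_eq_dvd_iff)
    then show "i = j"
      using ij(1,2) by simp
  qed
  ultimately show ?thesis
    by (simp add: card_image)
qed

lemma rooted_regular_tree: "rooted_regular_tree d V p"
  unfolding rooted_regular_tree_def
proof (intro conjI allI ballI)
  have "V 0 = {v 0 0}"
    unfolding level using vertex_eq_iff[of 0] by auto
  then show "card (V 0) = 1"
    by simp
  show "p n w \<in> V n" if "w \<in> V (Suc n)" for n w
    using that parent by (auto simp: level)
  show "card {w \<in> V (Suc n). p n w = u} = d" if "u \<in> V n" for n u
    using that parent_fibre by (auto simp: level)
qed

lemma transitive_action: "transitive_action G (V n) (\<phi> n)"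
proof -
  have bij: "\<phi> n g \<in> Bij (V n)" if g: "g \<in> carrier G" for g
  proof -
    have "\<phi> n g ` V n = V n"
      unfolding level image_image action[OF g]
      using bij_is_surj[OF h_bij[OF g]] by (metis image_image)
    moreover have "inj_on (\<phi> n g) (V n)"
      unfolding level inj_on_def using h_congruent[OF g] by (auto simp: action[OF g] vertex_eq_iff)
    ultimately show ?thesis
      using action_extensional[OF g] by (simp add: Bij_def bij_betw_def)
  qed
  have "\<phi> n \<in> hom G (BijGroup (V n))"
  proof (rule homI)
    fix g assume g: "g \<in> carrier G"
    then show "\<phi> n g \<in> carrier (BijGroup (V n))"
      using bij by (simp add: BijGroup_def)
    fix g' assume g': "g' \<in> carrier G"
    have "\<phi> n (g \<otimes> g') = compose (V n) (\<phi> n g) (\<phi> n g')"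
    proof (rule extensionalityI)
      show "\<phi> n (g \<otimes> g') \<in> extensional (V n)"
        using g g' by (intro action_extensional) simp
      show "compose (V n) (\<phi> n g) (\<phi> n g') \<in> extensional (V n)"
        by (simp add: compose_def)
      show "\<phi> n (g \<otimes> g') u = compose (V n) (\<phi> n g) (\<phi> n g') u" if "u \<in> V n" for u
        using that g g' by (auto simp: level compose_def action h_mult)
    qed
    then show "\<phi> n (g \<otimes> g') = \<phi> n g \<otimes>\<^bsub>BijGroup (V n)\<^esub> \<phi> n g'"
      using bij g g' by (simp add: BijGroup_def)
  qed
  moreover have "\<exists>g\<in>carrier G. \<phi> n g u = w" if uw: "u \<in> V n" "w \<in> V n" for u w
  proof -
    obtain k l where kl: "u = v n k" "w = v n l"
      using uw unfolding level by blast
    have "(\<lambda>i. 1 * i + (l - k)) \<in> dihedral_maps"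
      unfolding dihedral_maps_def by blast
    then obtain g where "g \<in> carrier G" "h g = (\<lambda>i. 1 * i + (l - k))"
      using h_image by (metis imageE)
    then show ?thesis
      using kl action by (intro bexI[of _ g]) simp_all
  qed
  ultimately show ?thesis
    by (intro transitive_action.intro group_action.intro transitive_action_axioms.intro
        group_hom.intro group_hom_axioms.intro group_BijGroup is_group) auto
qed

lemma level_transitive_action: "level_transitive_action d G V p \<phi>"
  unfolding level_transitive_action_def
proof (intro conjI allI ballI)
  show "countable (carrier G)"
    using countable_image_inj_on[OF _ h_inj] h_image countable_dihedral_maps by simp
  show "p n (\<phi> (Suc n) g w) = \<phi> n g (p n w)" if "g \<in> carrier G" "w \<in> V (Suc n)" for n g w
    using that by (auto simp: level action parent)
qed (intro rooted_regular_tree transitive_action is_group)+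

end

locale dihedral_tree_path = dihedral_tree_action +
  fixes x :: "nat \<Rightarrow> 'v"
  assumes path: "x \<in> tree_paths V p"
begin

text \<open>
  An integer representing the residue that labels the path on level \<open>n\<close>. The choices for different
  levels are independent, so the addresses are compatible only modulo \<open>d^n\<close>.
\<close>

definition address :: "nat \<Rightarrow> int" where
  "address n = (SOME k. x n = v n k)"

lemma path_vertex: "x n = v n (address n)"
proof -
  have "\<exists>k. x n = v n k"
    using path unfolding tree_paths_def level by auto
  then show ?thesis
    unfolding address_def by (rule someI_ex)
qed

lemma address_Suc: "int (d ^ n) dvd address (Suc n) - address n"
proof -
  have "p n (x (Suc n)) = x n"
    using path unfolding tree_paths_def by simp
  then show ?thesis
    by (simp only: path_vertex parent vertex_eq_iff)
qed

lemma mem_path_stabilizer_iff: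
  "g \<in> path_stabilizer G \<phi> x n \<longleftrightarrow> g \<in> carrier G \<and> int (d ^ n) dvd h g (address n) - address n"
  by (auto simp: path_stabilizer_def stabilizer_def path_vertex[of n] action vertex_eq_iff)

definition translation :: "int \<Rightarrow> 'a" where
  "translation j = inv_into (carrier G) h (\<lambda>k. 1 * k + j)"

definition reflection :: "int \<Rightarrow> 'a" where
  "reflection j = inv_into (carrier G) h (\<lambda>k. - 1 * k + j)"

lemma translation: "translation j \<in> carrier G" "h (translation j) k = k + j"
proof -
  have "(\<lambda>k. 1 * k + j) \<in> h ` carrier G"
    unfolding h_image dihedral_maps_def by blast
  from inv_into_into[OF this] f_inv_into_f[OF this]
  show "translation j \<in> carrier G" "h (translation j) k = k + j"
    unfolding translation_def by simp_all
qed

lemma reflection: "reflection j \<in> carrier G" "h (reflection j) k = j - k"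
proof -
  have "(\<lambda>k. - 1 * k + j) \<in> h ` carrier G"
    unfolding h_image dihedral_maps_def by blast
  from inv_into_into[OF this] f_inv_into_f[OF this]
  show "reflection j \<in> carrier G" "h (reflection j) k = j - k"
    unfolding reflection_def by simp_all
qed

lemma h_eqI:
  assumes "g \<in> carrier G" and "g' \<in> carrier G" and "\<And>k. h g k = h g' k"
  shows "g = g'"
  using inj_onD[OF h_inj ext[OF assms(3)] assms(1,2)] .

lemma translation_or_reflection:
  assumes "g \<in> carrier G"
  obtains j where "g = translation j" | j where "g = reflection j"
proof -
  obtain e j where e: "e \<in> {1, -1}" and h: "h g = (\<lambda>k. e * k + j)"
    using assms by (rule h_affine)
  from e consider "e = 1" | "e = -1"
    by blast
  then show thesis
  proof cases
    case 1
    have "g = translation j"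
      by (rule h_eqI) (simp_all add: assms translation h 1)
    then show thesis
      by (rule that(1))
  next
    case 2
    have "g = reflection j"
      by (rule h_eqI) (simp_all add: assms reflection h 2)
    then show thesis
      by (rule that(2))
  qed
qed

lemma reflection_mult: "reflection i \<otimes> reflection j = translation (i - j)"
  by (rule h_eqI) (simp_all add: reflection translation h_mult)

lemma reflection_square: "reflection j \<otimes> reflection j = \<one>"
  by (rule h_eqI) (simp_all add: reflection h_mult h_one)

lemma inv_reflection: "inv (reflection j) = reflection j"
  by (intro inv_equality reflection_square reflection)

sublocale chain: stabilizer_chain G \<phi> x
proof (intro stabilizer_chain.intro stabilizer_chain_axioms.intro is_group)
  fix n
  have "x n \<in> V n"
    using path_vertex level by auto
  then show "subgroup (path_stabilizer G \<phi> x n) G"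
    unfolding path_stabilizer_def
    by (rule group_action.stabilizer_subgroup[OF transitive_action.axioms(1)[OF transitive_action]])
  show "path_stabilizer G \<phi> x (Suc n) \<subseteq> path_stabilizer G \<phi> x n"
  proof
    fix g assume g: "g \<in> path_stabilizer G \<phi> x (Suc n)"
    then have gc: "g \<in> carrier G" and "int (d ^ Suc n) dvd h g (address (Suc n)) - address (Suc n)"
      by (simp_all add: mem_path_stabilizer_iff)
    then have "int (d ^ n) dvd h g (address (Suc n)) - address (Suc n)"
      by (metis dvd_mult_right of_nat_mult power_Suc)
    moreover have "int (d ^ n) dvd h g (address (Suc n)) - h g (address n)"
      using h_congruent[OF gc] address_Suc by simp
    moreover have "h g (address n) - address n = (h g (address (Suc n)) - address (Suc n))
        - (h g (address (Suc n)) - h g (address n)) + (address (Suc n) - address n)"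
      by simp
    ultimately have "int (d ^ n) dvd h g (address n) - address n"
      using address_Suc by (metis dvd_add dvd_diff)
    with gc show "g \<in> path_stabilizer G \<phi> x n"
      by (simp add: mem_path_stabilizer_iff)
  qed
qed

text \<open>
  A conjugate of the translation by \<open>j\<close> is the translation by \<open>j\<close> or by \<open>-j\<close>, so it fixes level \<open>n\<close>
  pointwise.
\<close>

lemma translation_in_core:
  assumes "int (d ^ n) dvd j"
  shows "translation j \<in> chain.core m n"
  unfolding chain.mem_core_iff
proof (intro conjI ballI translation)
  fix g assume "g \<in> chain.stab m"
  then have g: "g \<in> carrier G"
    by (rule chain.stab_closed)
  let ?a = "address n"
  have "h (inv g \<otimes> translation j \<otimes> g) ?a = h (inv g) (h g ?a + j)"
    using g by (simp add: h_mult translation)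
  moreover have "int (d ^ n) dvd h (inv g) (h g ?a + j) - h (inv g) (h g ?a)"
    unfolding h_congruent[OF inv_closed[OF g]] using assms by simp
  ultimately show "inv g \<otimes> translation j \<otimes> g \<in> chain.stab n"
    using g translation by (simp add: mem_path_stabilizer_iff h_inv)
qed

text \<open>
  Conjugation by the translation by \<open>d^m\<close>, which lies in \<open>G\<^sub>m\<close>, turns the reflection
  \<open>k \<mapsto> 2a\<^sub>n - k\<close> into \<open>k \<mapsto> 2a\<^sub>n - 2d^m - k\<close>, and \<open>d^n\<close> does not divide \<open>2d^m\<close> because \<open>d^2 > 2\<close>.
\<close>

lemma reflection_notin_core:
  assumes "m + 2 \<le> n"
  shows "reflection (2 * address n) \<notin> chain.core m n"
proof
  let ?t = "translation (int (d ^ m))" and ?r = "reflection (2 * address n)" and ?a = "address n"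
  assume "?r \<in> chain.core m n"
  moreover have "?t \<in> chain.stab m"
    by (simp add: mem_path_stabilizer_iff translation)
  ultimately have "inv ?t \<otimes> ?r \<otimes> ?t \<in> chain.stab n"
    unfolding chain.mem_core_iff by blast
  moreover have "inv ?t = translation (- int (d ^ m))"
    by (rule inv_equality) (auto intro!: h_eqI simp: translation h_mult h_one)
  ultimately have "int (d ^ n) dvd - (2 * int (d ^ m))"
    by (simp add: mem_path_stabilizer_iff translation reflection h_mult)
  then have "d ^ n dvd 2 * d ^ m"
    by (metis dvd_minus_iff int_dvd_int_iff of_nat_mult of_nat_numeral)
  moreover have "d ^ (m + 2) dvd d ^ n"
    using assms by (rule le_imp_power_dvd)
  ultimately have "d ^ m * d ^ 2 dvd d ^ m * 2"
    by (metis dvd_trans mult.commute power_add)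
  then have "d ^ 2 dvd 2"
    using degree by simp
  then have "d ^ 2 \<le> 2"
    by (rule dvd_imp_le) simp
  moreover have "2 ^ 2 \<le> d ^ 2"
    using degree by (rule power_mono) simp
  ultimately show False
    by simp
qed

sublocale coherent: coherent_involutions G \<phi> x "\<lambda>n. reflection (2 * address n)"
proof (unfold_locales)
  fix m n
  show "reflection (2 * address n) \<in> chain.stab n"
    by (simp add: mem_path_stabilizer_iff reflection)
  show "reflection (2 * address n) \<otimes> reflection (2 * address n) = \<one>"
    by (rule reflection_square)
  show "reflection (2 * address (Suc n)) \<otimes> inv reflection (2 * address n) \<in> chain.core m n"
    unfolding inv_reflection reflection_mult right_diff_distrib[symmetric]
    by (intro translation_in_core dvd_mult address_Suc)
  show "reflection (2 * address n) \<notin> chain.core m n" if "m + 2 \<le> n"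
    using that by (rule reflection_notin_core)
  show "chain.stab n \<subseteq> chain.core m n \<union> (chain.core m n #> reflection (2 * address n))"
  proof
    fix g assume g: "g \<in> chain.stab n"
    let ?a = "address n"
    from chain.stab_closed[OF g]
    show "g \<in> chain.core m n \<union> (chain.core m n #> reflection (2 * ?a))"
    proof (cases rule: translation_or_reflection)
      case (1 j)
      then show ?thesis
        using g translation_in_core by (simp add: mem_path_stabilizer_iff translation)
    next
      case (2 j)
      then have "int (d ^ n) dvd j - 2 * ?a"
        using g by (simp add: mem_path_stabilizer_iff reflection algebra_simps)
      then have "translation (j - 2 * ?a) \<in> chain.core m n"
        by (rule translation_in_core)
      moreover have "g = translation (j - 2 * ?a) \<otimes> reflection (2 * ?a)"
        unfolding 2 by (rule h_eqI) (simp_all add: translation reflection h_mult)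
      ultimately show ?thesis
        unfolding r_coset_def by blast
    qed
  qed
qed

theorem stable_with_discriminant_2: "stable_with_discriminant d G V p \<phi> x (integer_mod_group 2)"
  unfolding stable_with_discriminant_def
proof (intro conjI exI[of _ 0] allI impI level_transitive_action path)
  show "discriminant_map G \<phi> x k \<in> iso (discriminant_group G \<phi> x m) (discriminant_group G \<phi> x k)"
    if "0 \<le> m \<and> m < k" for m k
    using that by (intro coherent.discriminant_map_iso) simp
  show "discriminant_group G \<phi> x k \<cong> integer_mod_group 2" for k
    using group.iso_sym[OF group_integer_mod_group] coherent.involution_thread_iso
    by (metis is_isoI)
qed

end


section \<open>The cosine as a covering map\<close>

lemma cos_shift:
  assumes "e \<in> {1, -1::int}"
  shows "cos (of_int e * z + 2 * of_real pi * of_int k) = cos (z::complex)"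
proof -
  have "cos (of_int e * z) = cos z"
    using assms by auto
  moreover have "cos (of_int e * z + 2 * of_real pi * of_int k) = cos (of_int e * z)"
    by (rule complex_cos_eq[THEN iffD2], rule bexI[of _ "of_int k"]) auto
  ultimately show ?thesis
    by simp
qed

lemma cos_eq_iff_shift:
  "cos w = cos (z::complex) \<longleftrightarrow>
     (\<exists>e\<in>{1, -1}. \<exists>k. w = of_int e * z + 2 * of_real pi * of_int k)"
proof
  assume "cos w = cos z"
  then obtain n :: real where "n \<in> \<int>" and n: "w = z + of_real (2*n*pi) \<or> w = -z + of_real (2*n*pi)"
    using complex_cos_eq by blast
  then obtain k where "n = of_int k"
    by (auto elim: Ints_cases)
  with n have "w = of_int 1 * z + 2 * of_real pi * of_int k \<or> w = of_int (-1) * z + 2 * of_real pi * of_int k"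
    by (auto simp: algebra_simps)
  then show "\<exists>e\<in>{1, -1}. \<exists>k. w = of_int e * z + 2 * of_real pi * of_int k"
    by blast
next
  assume "\<exists>e\<in>{1, -1}. \<exists>k. w = of_int e * z + 2 * of_real pi * of_int k"
  then show "cos w = cos z"
    using cos_shift by blast
qed

lemma sin_eq_0_iff_cos: "sin (z::complex) = 0 \<longleftrightarrow> cos z \<in> {1, -1}"
proof -
  have "sin z = 0 \<longleftrightarrow> cos z ^ 2 = 1"
    using cos_squared_eq[of z] by simp
  then show ?thesis
    by (simp add: power2_eq_1_iff)
qed

text \<open>
  The group of the symmetries \<open>z \<mapsto> \<plusminus>z + 2\<pi>k\<close> of \<open>cos\<close> acts freely outside the zeros of \<open>sin\<close>.
\<close>

lemma shift_unique:
  assumes "sin (z::complex) \<noteq> 0" and "e \<in> {1, -1::int}" and "e' \<in> {1, -1::int}"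
    and eq: "of_int e * z + 2 * of_real pi * of_int k = of_int e' * z + 2 * of_real pi * of_int k'"
  shows "e = e'" and "k = k'"
proof -
  have *: "z = of_int n * of_real pi \<Longrightarrow> False" for n
    using assms(1) sin_eq_0 by (metis of_real_mult of_real_of_int_eq)
  show "e = e'"
  proof (rule ccontr)
    assume "e \<noteq> e'"
    with assms have "2 * z = 2 * (of_int (k' - k) * of_real pi) \<or> 2 * z = 2 * (of_int (k - k') * of_real pi)"
      by (auto simp: algebra_simps)
    then show False
      using * by (metis mult_cancel_left zero_neq_numeral)
  qed
  with eq show "k = k'"
    by simp
qed

text \<open>
  Around a point \<open>\<theta>\<close> with \<open>sin \<theta> \<noteq> 0\<close> take a ball \<open>U\<close> of radius at most \<open>1\<close> without zeros of \<open>sin\<close>.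
  Points of \<open>U\<close> with the same cosine agree up to a symmetry \<open>z \<mapsto> \<plusminus>z + 2\<pi>k\<close>, and the formula for the
  difference of two cosines shows that they are equal. Thus \<open>cos\<close> is a homeomorphism from \<open>U\<close> onto an
  open set, by invariance of domain, and the images of \<open>U\<close> under the symmetries are the sheets over it.
\<close>

theorem covering_space_cos: "covering_space {z::complex. sin z \<noteq> 0} cos (- {1, -1})"
proof
  let ?C = "{z::complex. sin z \<noteq> 0}"
  have openC: "open ?C"
    by (intro open_Collect_neq continuous_intros)
  show "continuous_on ?C cos"
    by (intro continuous_intros)
  show image: "cos ` ?C = - {1, -1}"
  proof
    show "cos ` ?C \<subseteq> - {1, -1}"
      using sin_eq_0_iff_cos by auto
    show "- {1, -1} \<subseteq> cos ` ?C"
    proof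
      fix z :: complex assume "z \<in> - {1, -1}"
      moreover have "cos (Arccos z) = z"
        by simp
      ultimately show "z \<in> cos ` ?C"
        using sin_eq_0_iff_cos[of "Arccos z"] by (metis (mono_tags, lifting) ComplD image_eqI mem_Collect_eq)
    qed
  qed
  fix z :: complex
  assume "z \<in> - {1, -1}"
  then obtain \<theta> where \<theta>: "sin \<theta> \<noteq> 0" "z = cos \<theta>"
    using image by (metis (mono_tags, lifting) imageE mem_Collect_eq)
  then obtain r0 where r0: "r0 > 0" "ball \<theta> r0 \<subseteq> ?C"
    using openC by (metis mem_Collect_eq openE)
  define U where "U = ball \<theta> (min r0 1)"
  have UC: "sin w \<noteq> 0" if "w \<in> U" for w
    using that r0 by (auto simp: U_def)
  have injU: "a = b" if "a \<in> U" "b \<in> U" "cos a = cos b" for a b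
  proof -
    \<comment> \<open>\<open>cos a - cos b = 2 sin ((a + b) / 2) sin ((b - a) / 2)\<close>; the first sine is nonzero at the midpoint, the second has a small argument.\<close>
    have "midpoint a b \<in> U"
      using that midpoint_in_closed_segment[of a b] closed_segment_subset[of a U b]
      by (auto simp only: U_def convex_ball)
    then have "sin ((a + b) / 2) \<noteq> 0"
      using UC by (simp add: midpoint_def scaleR_conv_of_real)
    moreover have "sin ((a + b) / 2) * sin ((b - a) / 2) = 0"
      using cos_diff_cos[of a b] that by simp
    ultimately have "sin ((b - a) / 2) = 0"
      by simp
    then obtain n :: int where n: "(b - a) / 2 = of_real (n * pi)"
      using sin_eq_0 by blast
    have "dist \<theta> a < 1" "dist \<theta> b < 1"
      using that by (auto simp: U_def)
    then have "norm (b - a) < 2"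
      using dist_triangle_less_add[of a \<theta> 1 b 1] by (simp add: dist_commute dist_norm norm_minus_commute)
    then have "norm ((b - a) / 2) < 1"
      by (simp add: norm_divide)
    then have "\<bar>real_of_int n\<bar> * pi < 1"
      unfolding n by (simp add: norm_mult abs_mult)
    moreover have "\<bar>real_of_int n\<bar> * pi \<ge> \<bar>real_of_int n\<bar> * 1"
      using pi_gt3 by (intro mult_left_mono) auto
    ultimately have "\<bar>real_of_int n\<bar> < 1"
      by linarith
    then have "n = 0"
      by linarith
    with n show "a = b"
      by simp
  qed
  define sheet where "sheet = (\<lambda>(e::int, k::int). (\<lambda>w. of_int e * w + 2 * of_real pi * of_int k) -` U)"
  let ?I = "{1, -1::int} \<times> (UNIV :: int set)"
  have open_sheet: "open (sheet i)" for i
    unfolding sheet_def U_def by (cases i) (auto intro!: open_vimage continuous_intros)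
  have cosE: "cos (of_int e * w + 2 * of_real pi * of_int k) = cos w" if "(e, k) \<in> ?I" for e k and w :: complex
    using cos_shift[of e w k] that by auto
  have sheetC: "sin w \<noteq> 0" if "i \<in> ?I" "w \<in> sheet i" for w i
  proof -
    obtain e k where i: "i = (e, k)"
      by (cases i)
    have "of_int e * w + 2 * of_real pi * of_int k \<in> U"
      using that by (simp add: i sheet_def)
    from UC[OF this] show ?thesis
      using cosE[of e k w] that(1) by (simp only: i sin_eq_0_iff_cos simp_thms)
  qed
  have cos_sheet: "cos ` sheet i = cos ` U" if "i \<in> ?I" for i
  proof -
    obtain e k where i: "i = (e, k)"
      by (cases i)
    with that have e: "e \<in> {1, -1}"
      by blast
    show ?thesis
    proof
      show "cos ` sheet i \<subseteq> cos ` U"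
      proof clarify
        fix w assume "w \<in> sheet i"
        then have "of_int e * w + 2 * of_real pi * of_int k \<in> U"
          by (simp add: i sheet_def)
        then show "cos w \<in> cos ` U"
          using cosE[of e k w] that unfolding i by (metis image_eqI)
      qed
      show "cos ` U \<subseteq> cos ` sheet i"
      proof
        fix y assume "y \<in> cos ` U"
        then obtain u where u: "u \<in> U" "y = cos u"
          by blast
        let ?w = "of_int e * (u - 2 * of_real pi * of_int k)"
        have eq: "of_int e * ?w + 2 * of_real pi * of_int k = u"
          using e by auto
        then have "?w \<in> sheet i"
          using u by (simp add: i sheet_def)
        moreover have "cos u = cos ?w"
          using cosE[OF that[unfolded i], of ?w] unfolding eq .
        ultimately show "y \<in> cos ` sheet i"
          unfolding u(2) by (intro image_eqI)
      qed
    qed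
  qed
  have sheet_eq: "i = j" if "i \<in> ?I" "j \<in> ?I" "w \<in> sheet i" "w \<in> sheet j" for i j w
  proof -
    obtain e k e' k' where ij: "i = (e, k)" "j = (e', k')"
      by (metis surj_pair)
    have "of_int e * w + 2 * of_real pi * of_int k = of_int e' * w + 2 * of_real pi * of_int k'"
    proof (rule injU)
      show "of_int e * w + 2 * of_real pi * of_int k \<in> U"
        "of_int e' * w + 2 * of_real pi * of_int k' \<in> U"
        using that(3,4) by (simp_all add: ij sheet_def)
      show "cos (of_int e * w + 2 * of_real pi * of_int k) = cos (of_int e' * w + 2 * of_real pi * of_int k')"
        using that(1,2) cosE[of e k w] cosE[of e' k' w] unfolding ij by (simp only: simp_thms)
    qed
    moreover have "sin w \<noteq> 0" "e \<in> {1, -1}" "e' \<in> {1, -1}"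
      using sheetC[of i w] that(1-3) unfolding ij by (blast+)
    ultimately show "i = j"
      using shift_unique[of w e e' k k'] unfolding ij by blast
  qed
  have inj_sheet: "inj_on cos (sheet i)" if i: "i \<in> ?I" for i
  proof (rule inj_onI)
    fix a b assume ab: "a \<in> sheet i" "b \<in> sheet i" "cos a = cos b"
    obtain e k where ek: "i = (e, k)"
      by (cases i)
    with i have "e \<noteq> 0"
      by auto
    have "of_int e * a + 2 * of_real pi * of_int k = of_int e * b + 2 * of_real pi * of_int k"
    proof (rule injU)
      show "of_int e * a + 2 * of_real pi * of_int k \<in> U"
        "of_int e * b + 2 * of_real pi * of_int k \<in> U"
        using ab(1,2) by (simp_all add: ek sheet_def)
      show "cos (of_int e * a + 2 * of_real pi * of_int k) = cos (of_int e * b + 2 * of_real pi * of_int k)"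
        using i ab(3) cosE[of e k a] cosE[of e k b] unfolding ek by (simp only: simp_thms)
    qed
    then show "a = b"
      using \<open>e \<noteq> 0\<close> by simp
  qed
  have zT: "z \<in> cos ` U"
    unfolding \<theta>(2) using r0(1) by (intro imageI) (simp add: U_def)
  have "open U"
    by (simp add: U_def)
  then have "open (cos ` U)"
    using inj_onI[of U cos, OF injU] by (intro invariance_of_domain continuous_on_cos continuous_on_id)
  moreover have "cos ` U \<subseteq> - {1, -1}"
  proof (rule image_subsetI)
    fix w assume "w \<in> U"
    from UC[OF this] show "cos w \<in> - {1, -1}"
      by (simp only: sin_eq_0_iff_cos Compl_iff not_False_eq_True)
  qed
  ultimately have openT: "openin (top_of_set (- {1, -1})) (cos ` U)"
    by (simp only: open_subset)
  have Un: "\<Union>(sheet ` ?I) = ?C \<inter> cos -` cos ` U"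
  proof
    show "\<Union>(sheet ` ?I) \<subseteq> ?C \<inter> cos -` cos ` U"
    proof (rule UN_least)
      fix i assume i: "i \<in> ?I"
      then show "sheet i \<subseteq> ?C \<inter> cos -` cos ` U"
        using sheetC[OF i] cos_sheet[OF i] by blast
    qed
    show "?C \<inter> cos -` cos ` U \<subseteq> \<Union>(sheet ` ?I)"
    proof
      fix w assume "w \<in> ?C \<inter> cos -` cos ` U"
      then obtain u where u: "u \<in> U" "cos u = cos w"
        by (metis IntD2 imageE vimage_eq)
      then obtain e k where "e \<in> {1,-1::int}" "u = of_int e * w + 2 * of_real pi * of_int k"
        using iffD1[OF cos_eq_iff_shift[of u w]] by blast
      then have "w \<in> sheet (e, k)" "(e, k) \<in> ?I"
        using u(1) by (simp_all add: sheet_def)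
      then show "w \<in> \<Union>(sheet ` ?I)"
        by blast
    qed
  qed
  have sheets_open: "openin (top_of_set ?C) u" if "u \<in> sheet ` ?I" for u
  proof -
    from that obtain i where i: "u = sheet i" "i \<in> ?I"
      by (rule imageE)
    have "u \<subseteq> ?C"
      unfolding i(1) using sheetC[OF i(2)] by (intro subsetI CollectI)
    then show ?thesis
      using open_sheet[of i] i(1) by (simp only: open_subset)
  qed
  have disj: "pairwise disjnt (sheet ` ?I)"
  proof (rule pairwiseI)
    fix a b assume ab: "a \<in> sheet ` ?I" "b \<in> sheet ` ?I" "a \<noteq> b"
    from ab(1) obtain i where i: "a = sheet i" "i \<in> ?I"
      by (rule imageE)
    from ab(2) obtain j where j: "b = sheet j" "j \<in> ?I"
      by (rule imageE)
    have False if "w \<in> a" "w \<in> b" for w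
      using sheet_eq[OF i(2) j(2), of w] that ab(3) unfolding i(1) j(1) by blast
    then show "disjnt a b"
      unfolding disjnt_iff by blast
  qed
  have homeo: "\<exists>q. homeomorphism u (cos ` U) cos q" if u: "u \<in> sheet ` ?I" for u
  proof -
    from u obtain i where i: "u = sheet i" "i \<in> ?I"
      by (rule imageE)
    obtain q where "homeomorphism (sheet i) (cos ` sheet i) cos q"
      by (rule invariance_of_domain_homeomorphism[OF open_sheet _ _ inj_sheet[OF i(2)]])
        (auto intro: continuous_intros)
    then show ?thesis
      using cos_sheet[OF i(2)] unfolding i(1) by (intro exI) (simp only:)
  qed
  show "\<exists>T. z \<in> T \<and> openin (top_of_set (- {1, -1})) T \<and>
    (\<exists>v. \<Union>v = ?C \<inter> cos -` T \<and> (\<forall>u\<in>v. openin (top_of_set ?C) u) \<and> pairwise disjnt v \<and>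
         (\<forall>u\<in>v. \<exists>q. homeomorphism u T cos q))"
    using zT openT Un sheets_open disj homeo
    by (intro exI[of _ "cos ` U"] exI[of _ "sheet ` ?I"] conjI ballI)
qed


section \<open>The post-critical set of a Chebyshev polynomial\<close>

lemma poly_chebyshev_cos: "poly (chebyshev_poly n) (cos \<theta>) = cos (of_nat n * (\<theta>::complex))"
proof (induction n rule: chebyshev_poly.induct)
  case (3 n)
  have "cos ((of_nat n + 1) * \<theta> + \<theta>) + cos ((of_nat n + 1) * \<theta> - \<theta>) = 2 * cos \<theta> * cos ((of_nat n + 1) * \<theta>)"
    unfolding cos_add cos_diff by simp
  then show ?case
    using 3 by (simp add: algebra_simps)
qed auto

lemma poly_chebyshev_funpow_cos:
  "(poly (chebyshev_poly d) ^^ n) (cos \<theta>) = cos (of_nat (d ^ n) * (\<theta>::complex))"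
  by (induction n) (simp_all add: poly_chebyshev_cos mult.assoc)

lemma pderiv_chebyshev_cos:
  "poly (pderiv (chebyshev_poly n)) (cos \<theta>) * sin \<theta> = of_nat n * sin (of_nat n * (\<theta>::complex))"
proof -
  have "((\<lambda>\<theta>. poly (chebyshev_poly n) (cos \<theta>)) has_field_derivative
          poly (pderiv (chebyshev_poly n)) (cos \<theta>) * - sin \<theta>) (at \<theta>)"
    by (rule DERIV_chain2[OF poly_DERIV DERIV_cos])
  moreover have "((\<lambda>\<theta>. poly (chebyshev_poly n) (cos \<theta>)) has_field_derivative
          - (of_nat n * sin (of_nat n * \<theta>))) (at \<theta>)"
    unfolding poly_chebyshev_cos by (auto intro!: derivative_eq_intros)
  ultimately have "poly (pderiv (chebyshev_poly n)) (cos \<theta>) * - sin \<theta> = - (of_nat n * sin (of_nat n * \<theta>))"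
    by (rule DERIV_unique)
  then show ?thesis
    by simp
qed

text \<open>
  Where the derivative of \<open>T\<^sub>n\<close> vanishes at \<open>cos \<theta>\<close>, so does \<open>sin (n \<theta>)\<close>, and \<open>T\<^sub>n (cos \<theta>) = cos (n \<theta>)\<close>
  has square \<open>1\<close>.
\<close>

lemma chebyshev_critical_value:
  assumes "n > 0" and "poly (pderiv (chebyshev_poly n)) (z::complex) = 0"
  shows "poly (chebyshev_poly n) z \<in> {1, -1}"
proof -
  obtain \<theta> where \<theta>: "z = cos \<theta>"
    using cos_Arccos by metis
  have "sin (of_nat n * \<theta>) = 0"
    using pderiv_chebyshev_cos[of n \<theta>] assms \<theta> by simp
  then show ?thesis
    unfolding \<theta> poly_chebyshev_cos by (simp only: sin_eq_0_iff_cos)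
qed

lemma chebyshev_pm1:
  assumes "z \<in> {1, -1::complex}"
  shows "(poly (chebyshev_poly d) ^^ n) z \<in> {1, -1}"
proof -
  obtain \<theta> where \<theta>: "z = cos \<theta>"
    using cos_Arccos by metis
  then obtain k :: int where k: "\<theta> = of_real (k * pi)"
    using assms sin_eq_0_iff_cos sin_eq_0 by metis
  have "sin (of_nat (d ^ n) * \<theta>) = 0"
    unfolding sin_eq_0 k by (rule exI[of _ "int (d ^ n) * k"]) simp
  then show ?thesis
    unfolding \<theta> poly_chebyshev_funpow_cos by (simp only: sin_eq_0_iff_cos)
qed

lemma map_option_funpow: "(map_option f ^^ n) P = map_option (f ^^ n) P" for f :: "'a \<Rightarrow> 'a"
  by (induction n) (simp_all add: option.map_comp option.map_ident o_def)

text \<open>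
  The strict bounds on \<open>k\<close> exclude the end points \<open>1\<close> and \<open>-1\<close>, at which \<open>sin\<close> vanishes as well and
  which are not critical.
\<close>

lemma chebyshev_critical_point:
  fixes k n :: nat
  assumes "0 < k" and "k < n"
  shows "Some (cos (of_real (k * pi / n))) \<in> critical_points (chebyshev_poly n)"
proof -
  let ?\<theta> = "complex_of_real (k * pi / n)"
  have "sin (k * pi / n) > 0"
    using assms by (intro sin_gt_zero) (auto simp: field_simps)
  then have "sin ?\<theta> \<noteq> 0"
    by (simp only: sin_of_real of_real_eq_0_iff)
  moreover have "sin (of_nat n * ?\<theta>) = 0"
    unfolding sin_eq_0 using assms by (intro exI[of _ "int k"]) simp
  ultimately have "poly (pderiv (chebyshev_poly n)) (cos ?\<theta>) = 0"
    using pderiv_chebyshev_cos[of n ?\<theta>] by simp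
  then show ?thesis
    by (simp add: critical_points_def)
qed

text \<open>
  The critical values are \<open>1\<close> or \<open>-1\<close>, and these two points are mapped into \<open>{1, -1}\<close> again. Both are
  attained: \<open>-1\<close> as the value at \<open>cos (\<pi>/d)\<close>, and \<open>1\<close> as the value at \<open>cos (2\<pi>/d)\<close> if \<open>d \<ge> 3\<close>. For
  \<open>d = 2\<close> the only finite critical point is \<open>0\<close>, which reaches \<open>1\<close> after two steps.
\<close>

lemma post_critical_complement_chebyshev:
  assumes "d \<ge> 2"
  shows "post_critical_complement (chebyshev_poly d) = - {1, -1}"
proof -
  let ?f = "poly (chebyshev_poly d) :: complex \<Rightarrow> complex"
  have "z \<in> {1, -1}" if "Some z \<in> post_critical_set (chebyshev_poly d)" for z
  proof -
    from that[unfolded post_critical_set_def]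
    obtain n where n: "n \<in> {1..}" and "Some z \<in> (map_option ?f ^^ n) ` critical_points (chebyshev_poly d)"
      by (rule UN_E)
    from this(2) obtain P where z: "Some z = (map_option ?f ^^ n) P"
      and P: "P \<in> critical_points (chebyshev_poly d)"
      by (rule imageE)
    obtain c where "P = Some c" "z = (?f ^^ n) c"
      using z unfolding map_option_funpow by (cases P) simp_all
    moreover obtain m where "n = Suc m"
      using n not0_implies_Suc by force
    ultimately have c: "P = Some c" "z = (?f ^^ Suc m) c"
      by simp_all
    then have "?f c \<in> {1, -1}"
      using P assms by (intro chebyshev_critical_value) (auto simp: critical_points_def)
    then show ?thesis
      unfolding c(2) funpow_Suc_right o_apply by (rule chebyshev_pm1)
  qed
  moreover have post: "Some ((?f ^^ n) (cos (of_real (k * pi / d)))) \<in> post_critical_set (chebyshev_poly d)"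
    if "n \<ge> 1" "0 < k" "k < d" for n k
    unfolding post_critical_set_def
    using that chebyshev_critical_point[of k d]
    by (intro UN_I[of n] image_eqI[OF _ chebyshev_critical_point[of k d]]) (simp_all add: map_option_funpow)
  have "Some (- 1) \<in> post_critical_set (chebyshev_poly d)"
    using post[of 1 1] assms by (simp add: poly_chebyshev_cos cos_of_real)
  moreover have "Some 1 \<in> post_critical_set (chebyshev_poly d)"
  proof (cases "d = 2")
    case True
    have "complex_of_real 4 * (of_real pi / 2) = of_real (2 * pi)"
      by simp
    then show ?thesis
      using post[of 2 1] True unfolding poly_chebyshev_funpow_cos
      by (simp add: cos_eq_1)
  next
    case False
    then show ?thesis
      using post[of 1 2] assms by (simp add: poly_chebyshev_cos cos_of_real)
  qed
  ultimately show ?thesis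
    unfolding post_critical_complement_def by auto
qed

section \<open>Lifting paths through the cosine\<close>

text \<open>
  Some lift of \<open>\<gamma>\<close> through \<open>cos\<close> leads from \<open>a\<close> to \<open>b\<close>. As a relation, path lifting is easier to compose
  and to move by the symmetries of \<open>cos\<close> than as a function.
\<close>

definition cos_transport :: "(real \<Rightarrow> complex) \<Rightarrow> complex \<Rightarrow> complex \<Rightarrow> bool" where
  "cos_transport \<gamma> a b \<longleftrightarrow> (\<exists>\<zeta>. path \<zeta> \<and> path_image \<zeta> \<subseteq> {z. sin z \<noteq> 0} \<and>
     pathstart \<zeta> = a \<and> pathfinish \<zeta> = b \<and> (\<forall>t\<in>{0..1}. cos (\<zeta> t) = \<gamma> t))"

lemma cos_transport_exists:
  assumes "path \<gamma>" and "path_image \<gamma> \<subseteq> - {1, -1}" and "pathstart \<gamma> = cos a"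
  shows "\<exists>b. cos_transport \<gamma> a b"
proof -
  have "cos a \<notin> {1, -1}"
    using assms pathstart_in_path_image[of \<gamma>] by (metis Compl_iff subsetD)
  then have "a \<in> {z. sin z \<noteq> 0}"
    by (simp only: sin_eq_0_iff_cos mem_Collect_eq not_False_eq_True)
  from covering_space_lift_path_strong[OF covering_space_cos this assms]
  show ?thesis
    unfolding cos_transport_def by metis
qed

lemma cos_transport_image:
  assumes "cos_transport \<gamma> a b"
  shows "path \<gamma>" and "path_image \<gamma> \<subseteq> - {1, -1}" and "pathstart \<gamma> = cos a" and "pathfinish \<gamma> = cos b"
proof -
  obtain \<zeta> where \<zeta>: "path \<zeta>" "path_image \<zeta> \<subseteq> {z. sin z \<noteq> 0}" "pathstart \<zeta> = a" "pathfinish \<zeta> = b"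
      "\<And>t. t \<in> {0..1} \<Longrightarrow> cos (\<zeta> t) = \<gamma> t"
    using assms unfolding cos_transport_def by blast
  have "path (\<lambda>t. cos (\<zeta> t))"
    using \<zeta>(1) unfolding path_def by (intro continuous_intros)
  then show "path \<gamma>"
    unfolding path_def using \<zeta>(5) by (rule continuous_on_eq)
  show "path_image \<gamma> \<subseteq> - {1, -1}"
    unfolding path_image_def
  proof (rule image_subsetI)
    fix t :: real assume t: "t \<in> {0..1}"
    then have "sin (\<zeta> t) \<noteq> 0"
      using \<zeta>(2) by (auto simp: path_image_def image_subset_iff)
    then show "\<gamma> t \<in> - {1, -1}"
      unfolding \<zeta>(5)[OF t, symmetric] by (simp only: sin_eq_0_iff_cos Compl_iff not_False_eq_True)
  qed
  show "pathstart \<gamma> = cos a" "pathfinish \<gamma> = cos b"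
    using \<zeta>(3-5) by (auto simp: pathstart_def pathfinish_def)
qed

lemma cos_transport_homotopic:
  assumes "homotopic_paths (- {1, -1}) \<gamma> \<gamma>'" and "cos_transport \<gamma> a b" and "cos_transport \<gamma>' a b'"
  shows "b = b'"
proof -
  obtain \<zeta> where \<zeta>: "path \<zeta>" "path_image \<zeta> \<subseteq> {z. sin z \<noteq> 0}" "pathstart \<zeta> = a" "pathfinish \<zeta> = b"
      "\<And>t. t \<in> {0..1} \<Longrightarrow> cos (\<zeta> t) = \<gamma> t"
    using assms unfolding cos_transport_def by blast
  obtain \<zeta>' where \<zeta>': "path \<zeta>'" "path_image \<zeta>' \<subseteq> {z. sin z \<noteq> 0}" "pathstart \<zeta>' = a" "pathfinish \<zeta>' = b'"
      "\<And>t. t \<in> {0..1} \<Longrightarrow> cos (\<zeta>' t) = \<gamma>' t"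
    using assms unfolding cos_transport_def by blast
  show ?thesis
    using covering_space_monodromy[OF covering_space_cos cos_transport_image(1,2)[OF assms(2)]
        cos_transport_image(1,2)[OF assms(3)] assms(1) \<zeta>(1,2,5) \<zeta>'(1,2,5)] \<zeta>(3,4) \<zeta>'(3,4)
    by metis
qed

lemma cos_transport_shift:
  assumes "cos_transport \<gamma> a b" and "e \<in> {1, -1::int}"
  shows "cos_transport \<gamma> (of_int e * a + 2 * of_real pi * of_int k) (of_int e * b + 2 * of_real pi * of_int k)"
proof -
  obtain \<zeta> where \<zeta>: "path \<zeta>" "path_image \<zeta> \<subseteq> {z. sin z \<noteq> 0}" "pathstart \<zeta> = a" "pathfinish \<zeta> = b"
      "\<And>t. t \<in> {0..1} \<Longrightarrow> cos (\<zeta> t) = \<gamma> t"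
    using assms unfolding cos_transport_def by blast
  let ?\<zeta> = "\<lambda>t. of_int e * \<zeta> t + 2 * of_real pi * of_int k"
  have "path ?\<zeta>"
    using \<zeta>(1) unfolding path_def by (intro continuous_intros)
  moreover have "path_image ?\<zeta> \<subseteq> {z. sin z \<noteq> 0}"
    using \<zeta>(2) cos_shift[OF assms(2)] unfolding path_image_def sin_eq_0_iff_cos by auto
  ultimately show ?thesis
    unfolding cos_transport_def using \<zeta>(3-5) cos_shift[OF assms(2)]
    by (intro exI[of _ ?\<zeta>]) (simp add: pathstart_def pathfinish_def)
qed

lemma cos_transport_join:
  assumes "cos_transport \<gamma> a b" and "cos_transport \<delta> b c"
  shows "cos_transport (\<gamma> +++ \<delta>) a c"
proof -
  obtain \<zeta> where \<zeta>: "path \<zeta>" "path_image \<zeta> \<subseteq> {z. sin z \<noteq> 0}" "pathstart \<zeta> = a" "pathfinish \<zeta> = b"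
      "\<And>t. t \<in> {0..1} \<Longrightarrow> cos (\<zeta> t) = \<gamma> t"
    using assms unfolding cos_transport_def by blast
  obtain \<zeta>' where \<zeta>': "path \<zeta>'" "path_image \<zeta>' \<subseteq> {z. sin z \<noteq> 0}" "pathstart \<zeta>' = b" "pathfinish \<zeta>' = c"
      "\<And>t. t \<in> {0..1} \<Longrightarrow> cos (\<zeta>' t) = \<delta> t"
    using assms unfolding cos_transport_def by blast
  have "cos ((\<zeta> +++ \<zeta>') t) = (\<gamma> +++ \<delta>) t" if "t \<in> {0..1}" for t
    using that \<zeta>(5) \<zeta>'(5) by (auto simp: joinpaths_def)
  then show ?thesis
    unfolding cos_transport_def using \<zeta> \<zeta>' by (intro exI[of _ "\<zeta> +++ \<zeta>'"]) (auto simp: path_image_join)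
qed

text \<open>
  The zeros of \<open>sin\<close> form a countable set, whose complement in the plane is path connected; the
  cosine of a path in this complement is the required path.
\<close>

lemma cos_transport_realise:
  assumes "sin a \<noteq> 0" and "sin b \<noteq> 0"
  shows "\<exists>\<gamma>. cos_transport \<gamma> a b"
proof -
  have "{z::complex. sin z = 0} = range (\<lambda>n::int. complex_of_real (of_int n * pi))"
    unfolding sin_eq_0 by auto
  then have "countable {z::complex. sin z = 0}"
    by simp
  then have "path_connected (- {z::complex. sin z = 0})"
    by (intro path_connected_complement_countable) simp
  then obtain \<zeta> where "path \<zeta>" "path_image \<zeta> \<subseteq> - {z. sin z = 0}" "pathstart \<zeta> = a" "pathfinish \<zeta> = b"
    unfolding path_connected_def using assms by blast
  then show ?thesis
    unfolding cos_transport_def by (intro exI[of _ "cos \<circ> \<zeta>"] exI[of _ \<zeta>]) auto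
qed


section \<open>The fundamental group\<close>

text \<open>
  For a loop \<open>\<gamma>\<close> at \<open>s\<close> in \<open>M\<close> this is its element of the fundamental group: a path homotopic to \<open>\<gamma>\<close> with
  fixed end points is again a loop at \<open>s\<close>.
\<close>

definition path_class :: "'a::topological_space set \<Rightarrow> (real \<Rightarrow> 'a) \<Rightarrow> (real \<Rightarrow> 'a) set" where
  "path_class M \<gamma> = {\<rho>. homotopic_paths M \<gamma> \<rho>}"

lemma path_class_eqI: "homotopic_paths M \<gamma> \<delta> \<Longrightarrow> path_class M \<gamma> = path_class M \<delta>"
  unfolding path_class_def
  using homotopic_paths_trans[of M \<gamma> \<delta>] homotopic_paths_trans[of M \<delta> \<gamma>] homotopic_paths_sym[of M \<gamma> \<delta>]
  by blast

lemma loops_atD: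
  assumes "\<gamma> \<in> loops_at M s"
  shows "path \<gamma>" "path_image \<gamma> \<subseteq> M" "pathstart \<gamma> = s" "pathfinish \<gamma> = s" "homotopic_paths M \<gamma> \<gamma>"
  using assms by (auto simp: loops_at_def)

lemma loops_at_join:
  assumes "\<gamma> \<in> loops_at M s" and "\<delta> \<in> loops_at M s"
  shows "\<gamma> +++ \<delta> \<in> loops_at M s"
  using loops_atD[OF assms(1)] loops_atD[OF assms(2)] unfolding loops_at_def
  by (simp add: path_image_join)

lemma carrier_fundamental_group:
  "carrier (fundamental_group M s) = path_class M ` loops_at M s"
  by (auto simp: fundamental_group_def quotient_def path_class_def)

lemma one_fundamental_group: "\<one>\<^bsub>fundamental_group M s\<^esub> = path_class M (\<lambda>_. s)"
  by (simp add: fundamental_group_def path_class_def)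

lemma mult_fundamental_group:
  assumes "\<gamma> \<in> loops_at M s" and "\<delta> \<in> loops_at M s"
  shows "path_class M \<gamma> \<otimes>\<^bsub>fundamental_group M s\<^esub> path_class M \<delta> = path_class M (\<delta> +++ \<gamma>)"
proof -
  have "homotopic_paths M (\<delta> +++ \<gamma>) \<rho>"
    if "homotopic_paths M \<gamma> \<gamma>'" "homotopic_paths M \<delta> \<delta>'" "homotopic_paths M (\<delta>' +++ \<gamma>') \<rho>" for \<gamma>' \<delta>' \<rho>
  proof -
    have "homotopic_paths M (\<delta> +++ \<gamma>) (\<delta>' +++ \<gamma>')"
      using that loops_atD[OF assms(1)] loops_atD[OF assms(2)] by (intro homotopic_paths_join) auto
    then show ?thesis
      using that(3) homotopic_paths_trans by blast
  qed
  then show ?thesis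
    using loops_atD(5)[OF assms(1)] loops_atD(5)[OF assms(2)]
    unfolding fundamental_group_def path_class_def monoid.simps mem_Collect_eq Bex_def by blast
qed

theorem group_fundamental_group:
  fixes s :: "'a::real_normed_vector"
  assumes "s \<in> M"
  shows "group (fundamental_group M s)"
proof (rule groupI)
  have const: "(\<lambda>_. s) = linepath s s"
    by (simp add: linepath_refl)
  have loop1: "(\<lambda>_. s) \<in> loops_at M s"
    unfolding const using assms by (simp add: loops_at_def)
  then show "\<one>\<^bsub>fundamental_group M s\<^esub> \<in> carrier (fundamental_group M s)"
    by (simp add: carrier_fundamental_group one_fundamental_group)
  fix x assume "x \<in> carrier (fundamental_group M s)"
  then obtain \<gamma> where \<gamma>: "\<gamma> \<in> loops_at M s" "x = path_class M \<gamma>"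
    by (auto simp: carrier_fundamental_group)
  note \<gamma>' = loops_atD[OF \<gamma>(1)]
  show "\<one>\<^bsub>fundamental_group M s\<^esub> \<otimes>\<^bsub>fundamental_group M s\<^esub> x = x"
    unfolding one_fundamental_group \<gamma>(2) mult_fundamental_group[OF loop1 \<gamma>(1)]
    unfolding const using \<gamma>' by (intro path_class_eqI homotopic_paths_rid') auto
  have "reversepath \<gamma> \<in> loops_at M s"
    using \<gamma>' by (simp add: loops_at_def)
  moreover have "path_class M (\<gamma> +++ reversepath \<gamma>) = path_class M (\<lambda>_. s)"
    unfolding const using \<gamma>' homotopic_paths_rinv[of \<gamma> M] by (intro path_class_eqI) simp
  ultimately show "\<exists>y\<in>carrier (fundamental_group M s). y \<otimes>\<^bsub>fundamental_group M s\<^esub> x = \<one>\<^bsub>fundamental_group M s\<^esub>"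
    unfolding \<gamma>(2) carrier_fundamental_group one_fundamental_group
    using mult_fundamental_group[OF _ \<gamma>(1)] by (intro bexI[of _ "path_class M (reversepath \<gamma>)"]) auto
  fix y assume "y \<in> carrier (fundamental_group M s)"
  then obtain \<delta> where \<delta>: "\<delta> \<in> loops_at M s" "y = path_class M \<delta>"
    by (auto simp: carrier_fundamental_group)
  note \<delta>' = loops_atD[OF \<delta>(1)]
  show "x \<otimes>\<^bsub>fundamental_group M s\<^esub> y \<in> carrier (fundamental_group M s)"
    unfolding \<gamma>(2) \<delta>(2) mult_fundamental_group[OF \<gamma>(1) \<delta>(1)] carrier_fundamental_group
    by (intro imageI loops_at_join \<gamma> \<delta>)
  fix z assume "z \<in> carrier (fundamental_group M s)"
  then obtain \<eta> where \<eta>: "\<eta> \<in> loops_at M s" "z = path_class M \<eta>"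
    by (auto simp: carrier_fundamental_group)
  note \<eta>' = loops_atD[OF \<eta>(1)]
  show "x \<otimes>\<^bsub>fundamental_group M s\<^esub> y \<otimes>\<^bsub>fundamental_group M s\<^esub> z =
        x \<otimes>\<^bsub>fundamental_group M s\<^esub> (y \<otimes>\<^bsub>fundamental_group M s\<^esub> z)"
    unfolding \<gamma>(2) \<delta>(2) \<eta>(2)
    using \<gamma> \<delta> \<eta> \<gamma>' \<delta>' \<eta>'
    by (simp add: mult_fundamental_group loops_at_join)
      (intro path_class_eqI homotopic_paths_assoc; simp)
qed


section \<open>The action of the fundamental group on the lifts of the base point\<close>

abbreviation cos_lift :: "complex \<Rightarrow> int \<Rightarrow> complex" where
  "cos_lift \<theta> k \<equiv> \<theta> + 2 * of_real pi * of_int k"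

text \<open>
  The points over \<open>cos \<theta>\<close> are the \<open>\<plusminus>(\<theta> + 2\<pi>l)\<close>. The sign is dropped here, since both points
  have the same cosine also after division by \<open>d^n\<close>.
\<close>

definition cos_monodromy :: "complex \<Rightarrow> (real \<Rightarrow> complex) \<Rightarrow> int \<Rightarrow> int \<Rightarrow> bool" where
  "cos_monodromy \<theta> \<gamma> k l \<longleftrightarrow>
     (\<exists>e\<in>{1, -1::int}. cos_transport \<gamma> (cos_lift \<theta> k) (of_int e * cos_lift \<theta> l))"

text \<open>
  If the lift starting at \<open>\<theta>\<close> ends at \<open>e \<theta> + 2\<pi>j\<close>, then its translate by \<open>2\<pi>k\<close> is the lift starting
  at \<open>\<theta> + 2\<pi>k\<close>, and it ends at \<open>e \<theta> + 2\<pi>(j + k) = e (\<theta> + 2\<pi>(e k + e j))\<close>.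
\<close>

lemma cos_monodromy_exists:
  assumes "\<gamma> \<in> loops_at (- {1, -1}) (cos \<theta>)"
  obtains h where "h \<in> dihedral_maps" and "\<And>k. cos_monodromy \<theta> \<gamma> k (h k)"
proof -
  obtain b where b: "cos_transport \<gamma> \<theta> b"
    using cos_transport_exists[of \<gamma> \<theta>] loops_atD[OF assms] by auto
  have "cos b = cos \<theta>"
    using cos_transport_image(4)[OF b] loops_atD(4)[OF assms] by simp
  then obtain e j where e: "e \<in> {1, -1::int}" and j: "b = of_int e * \<theta> + 2 * of_real pi * of_int j"
    using cos_eq_iff_shift by blast
  have "cos_monodromy \<theta> \<gamma> k (e * k + e * j)" for k
  proof -
    have "cos_transport \<gamma> (of_int 1 * \<theta> + 2 * of_real pi * of_int k) (of_int 1 * b + 2 * of_real pi * of_int k)"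
      by (rule cos_transport_shift[OF b]) simp
    moreover have "of_int 1 * b + 2 * of_real pi * of_int k = of_int e * cos_lift \<theta> (e * k + e * j)"
      using e unfolding j by (auto simp: algebra_simps)
    ultimately show ?thesis
      unfolding cos_monodromy_def using e by (intro bexI[of _ e]) simp_all
  qed
  moreover have "(\<lambda>k. e * k + e * j) \<in> dihedral_maps"
    unfolding dihedral_maps_def using e by blast
  ultimately show ?thesis
    using that by blast
qed

lemma cos_monodromy_homotopic:
  assumes "sin \<theta> \<noteq> 0" and "homotopic_paths (- {1, -1}) \<gamma> \<gamma>'"
    and "cos_monodromy \<theta> \<gamma> k l" and "cos_monodromy \<theta> \<gamma>' k l'"
  shows "l = l'"
proof -
  obtain e where e: "e \<in> {1, -1::int}" "cos_transport \<gamma> (cos_lift \<theta> k) (of_int e * cos_lift \<theta> l)"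
    using assms(3) unfolding cos_monodromy_def by blast
  obtain e' where e': "e' \<in> {1, -1::int}" "cos_transport \<gamma>' (cos_lift \<theta> k) (of_int e' * cos_lift \<theta> l')"
    using assms(4) unfolding cos_monodromy_def by blast
  have "of_int e * cos_lift \<theta> l = of_int e' * cos_lift \<theta> l'"
    by (rule cos_transport_homotopic[OF assms(2) e(2) e'(2)])
  then have "of_int e * \<theta> + 2 * of_real pi * of_int (e * l) = of_int e' * \<theta> + 2 * of_real pi * of_int (e' * l')"
    by (simp add: algebra_simps)
  from shift_unique[OF assms(1) e(1) e'(1) this] show ?thesis
    using e(1) by auto
qed

text \<open>
  The lift of \<open>\<gamma>\<close> may end at \<open>-(\<theta> + 2\<pi>l)\<close>. It is then continued by the negative of the lift of \<open>\<delta>\<close>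
  that starts at \<open>\<theta> + 2\<pi>l\<close>.
\<close>

lemma cos_monodromy_join:
  assumes "cos_monodromy \<theta> \<gamma> k l" and "cos_monodromy \<theta> \<delta> l m"
  shows "cos_monodromy \<theta> (\<gamma> +++ \<delta>) k m"
proof -
  obtain e where e: "e \<in> {1, -1::int}" "cos_transport \<gamma> (cos_lift \<theta> k) (of_int e * cos_lift \<theta> l)"
    using assms(1) unfolding cos_monodromy_def by blast
  obtain e' where e': "e' \<in> {1, -1::int}" "cos_transport \<delta> (cos_lift \<theta> l) (of_int e' * cos_lift \<theta> m)"
    using assms(2) unfolding cos_monodromy_def by blast
  have "cos_transport \<delta> (of_int e * cos_lift \<theta> l) (of_int (e * e') * cos_lift \<theta> m)"
    using cos_transport_shift[OF e'(2) e(1), of 0] by (simp add: mult.assoc)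
  then have "cos_transport (\<gamma> +++ \<delta>) (cos_lift \<theta> k) (of_int (e * e') * cos_lift \<theta> m)"
    by (rule cos_transport_join[OF e(2)])
  moreover have "e * e' \<in> {1, -1}"
    using e(1) e'(1) by auto
  ultimately show ?thesis
    unfolding cos_monodromy_def by blast
qed

lemma cos_monodromy_realise:
  assumes "sin \<theta> \<noteq> 0" and "h \<in> dihedral_maps"
  obtains \<gamma> where "\<gamma> \<in> loops_at (- {1, -1}) (cos \<theta>)" and "\<And>k. cos_monodromy \<theta> \<gamma> k (h k)"
proof -
  obtain e j where e: "e \<in> {1, -1}" and h: "h = (\<lambda>k. e * k + j)"
    using assms(2) unfolding dihedral_maps_def by blast
  let ?b = "of_int e * \<theta> + 2 * of_real pi * of_int (e * j)"
  have cb: "cos ?b = cos \<theta>"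
    by (rule cos_shift[OF e])
  then have "sin ?b \<noteq> 0"
    using assms(1) by (simp only: sin_eq_0_iff_cos not_False_eq_True)
  then obtain \<gamma> where \<gamma>: "cos_transport \<gamma> \<theta> ?b"
    using cos_transport_realise[OF assms(1)] by blast
  have "\<gamma> \<in> loops_at (- {1, -1}) (cos \<theta>)"
    unfolding loops_at_def using cos_transport_image[OF \<gamma>] cb by simp
  moreover have "cos_monodromy \<theta> \<gamma> k (h k)" for k
  proof -
    have "cos_transport \<gamma> (of_int 1 * \<theta> + 2 * of_real pi * of_int k) (of_int 1 * ?b + 2 * of_real pi * of_int k)"
      by (rule cos_transport_shift[OF \<gamma>]) simp
    moreover have "of_int 1 * ?b + 2 * of_real pi * of_int k = of_int e * cos_lift \<theta> (h k)"
      using e unfolding h by (auto simp: algebra_simps)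
    ultimately show ?thesis
      unfolding cos_monodromy_def using e by (intro bexI[of _ e]) simp_all
  qed
  ultimately show ?thesis
    using that by blast
qed

definition deck_map :: "complex \<Rightarrow> (real \<Rightarrow> complex) set \<Rightarrow> int \<Rightarrow> int" where
  "deck_map \<theta> A k = (THE l. \<exists>\<gamma>\<in>A. cos_monodromy \<theta> \<gamma> k l)"

lemma deck_map_eqI:
  assumes "sin \<theta> \<noteq> 0" and "\<gamma> \<in> loops_at (- {1, -1}) (cos \<theta>)" and "cos_monodromy \<theta> \<gamma> k l"
  shows "deck_map \<theta> (path_class (- {1, -1}) \<gamma>) k = l"
  unfolding deck_map_def
proof (rule the_equality)
  show "\<exists>\<gamma>\<in>path_class (- {1, -1}) \<gamma>. cos_monodromy \<theta> \<gamma> k l"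
    using assms(3) loops_atD(5)[OF assms(2)] unfolding path_class_def mem_Collect_eq Bex_def by blast
  show "l' = l" if "\<exists>\<gamma>\<in>path_class (- {1, -1}) \<gamma>. cos_monodromy \<theta> \<gamma> k l'" for l'
    using that cos_monodromy_homotopic[OF assms(1) _ assms(3)] by (auto simp: path_class_def)
qed

lemma deck_map_loop:
  assumes "sin \<theta> \<noteq> 0" and "\<gamma> \<in> loops_at (- {1, -1}) (cos \<theta>)"
  shows "deck_map \<theta> (path_class (- {1, -1}) \<gamma>) \<in> dihedral_maps"
    and "cos_monodromy \<theta> \<gamma> k (deck_map \<theta> (path_class (- {1, -1}) \<gamma>) k)"
proof -
  obtain h where h: "h \<in> dihedral_maps" "\<And>k. cos_monodromy \<theta> \<gamma> k (h k)"
    using cos_monodromy_exists[OF assms(2)] by blast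
  have "deck_map \<theta> (path_class (- {1, -1}) \<gamma>) = h"
    using deck_map_eqI[OF assms h(2)] by blast
  with h show "deck_map \<theta> (path_class (- {1, -1}) \<gamma>) \<in> dihedral_maps"
    "cos_monodromy \<theta> \<gamma> k (deck_map \<theta> (path_class (- {1, -1}) \<gamma>) k)"
    by simp_all
qed

lemma dihedral_maps_bij: "dihedral_maps \<subseteq> Bij UNIV"
proof
  fix h assume "h \<in> dihedral_maps"
  then obtain e j where e: "e \<in> {1, -1}" and h: "h = (\<lambda>k. e * k + j)"
    unfolding dihedral_maps_def by blast
  have "bij h"
    using e unfolding h by (intro o_bij[of "\<lambda>k. e * (k - j)"]) (auto simp: o_def)
  then show "h \<in> Bij UNIV"
    by (simp add: Bij_def)
qed

text \<open>
  The product \<open>A \<otimes> B\<close> traverses a loop of \<open>B\<close> first, so \<open>deck_map\<close> turns products into compositions in the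
  same order.
\<close>

theorem deck_map_hom:
  assumes "sin \<theta> \<noteq> 0"
  shows "group_hom (fundamental_group (- {1, -1}) (cos \<theta>)) (BijGroup UNIV) (deck_map \<theta>)"
    and "deck_map \<theta> ` carrier (fundamental_group (- {1, -1}) (cos \<theta>)) = dihedral_maps"
proof -
  let ?G = "fundamental_group (- {1, -1}) (cos \<theta>)"
  have s: "cos \<theta> \<in> - {1, -1}"
    using assms by (simp only: sin_eq_0_iff_cos Compl_iff not_False_eq_True)
  show image: "deck_map \<theta> ` carrier ?G = dihedral_maps"
  proof
    show "deck_map \<theta> ` carrier ?G \<subseteq> dihedral_maps"
      using deck_map_loop(1)[OF assms] by (auto simp: carrier_fundamental_group)
    show "dihedral_maps \<subseteq> deck_map \<theta> ` carrier ?G"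
    proof
      fix h assume "h \<in> dihedral_maps"
      then obtain \<gamma> where \<gamma>: "\<gamma> \<in> loops_at (- {1, -1}) (cos \<theta>)" "\<And>k. cos_monodromy \<theta> \<gamma> k (h k)"
        using cos_monodromy_realise[OF assms] by blast
      then have "deck_map \<theta> (path_class (- {1, -1}) \<gamma>) = h"
        using deck_map_eqI[OF assms \<gamma>] by blast
      then show "h \<in> deck_map \<theta> ` carrier ?G"
        using \<gamma>(1) unfolding carrier_fundamental_group by blast
    qed
  qed
  have "deck_map \<theta> \<in> hom ?G (BijGroup UNIV)"
  proof (rule homI)
    fix A assume A: "A \<in> carrier ?G"
    then show "deck_map \<theta> A \<in> carrier (BijGroup UNIV)"
      using image dihedral_maps_bij by (auto simp: BijGroup_def)
    fix B assume B: "B \<in> carrier ?G"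
    obtain \<gamma> \<delta> where \<gamma>: "\<gamma> \<in> loops_at (- {1, -1}) (cos \<theta>)" "A = path_class (- {1, -1}) \<gamma>"
      and \<delta>: "\<delta> \<in> loops_at (- {1, -1}) (cos \<theta>)" "B = path_class (- {1, -1}) \<delta>"
      using A B unfolding carrier_fundamental_group by blast
    have "deck_map \<theta> (A \<otimes>\<^bsub>?G\<^esub> B) k = deck_map \<theta> A (deck_map \<theta> B k)" for k
      unfolding \<gamma>(2) \<delta>(2) mult_fundamental_group[OF \<gamma>(1) \<delta>(1)]
      by (intro deck_map_eqI cos_monodromy_join[OF deck_map_loop(2) deck_map_loop(2)] loops_at_join assms \<gamma> \<delta>)
    moreover have "deck_map \<theta> A \<in> Bij UNIV" "deck_map \<theta> B \<in> Bij UNIV"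
      using A B image dihedral_maps_bij by auto
    ultimately show "deck_map \<theta> (A \<otimes>\<^bsub>?G\<^esub> B) = deck_map \<theta> A \<otimes>\<^bsub>BijGroup UNIV\<^esub> deck_map \<theta> B"
      by (auto simp: BijGroup_def compose_def)
  qed
  then show "group_hom ?G (BijGroup UNIV) (deck_map \<theta>)"
    by (intro group_hom.intro group_hom_axioms.intro group_fundamental_group[OF s] group_BijGroup)
qed


section \<open>The tree of preimages\<close>

definition chebyshev_vertex :: "nat \<Rightarrow> complex \<Rightarrow> nat \<Rightarrow> int \<Rightarrow> complex" where
  "chebyshev_vertex d \<theta> n k = cos (cos_lift \<theta> k / of_nat (d ^ n))"

lemma chebyshev_vertex_root:
  assumes "d > 0"
  shows "(poly (chebyshev_poly d) ^^ n) (chebyshev_vertex d \<theta> n k) = cos \<theta>"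
proof -
  have "of_nat (d ^ n) * (cos_lift \<theta> k / of_nat (d ^ n)) = of_int 1 * \<theta> + 2 * of_real pi * of_int k"
    using assms by simp
  then show ?thesis
    unfolding chebyshev_vertex_def poly_chebyshev_funpow_cos
    by (simp only: cos_shift[of 1] insert_iff simp_thms)
qed

text \<open>
  A point \<open>cos \<phi>\<close> is mapped to \<open>cos \<theta>\<close> by the \<open>n\<close>-th iterate exactly when \<open>d^n \<phi>\<close> is \<open>\<theta>\<close> up to a
  symmetry of \<open>cos\<close>. The sign can be moved to \<open>\<phi>\<close>, where \<open>cos\<close> does not see it.
\<close>

lemma preimage_level_chebyshev:
  assumes "d > 0"
  shows "preimage_level (chebyshev_poly d) (cos \<theta>) n = range (chebyshev_vertex d \<theta> n)"
proof
  show "range (chebyshev_vertex d \<theta> n) \<subseteq> preimage_level (chebyshev_poly d) (cos \<theta>) n"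
    using chebyshev_vertex_root[OF assms] by (auto simp: preimage_level_def)
  show "preimage_level (chebyshev_poly d) (cos \<theta>) n \<subseteq> range (chebyshev_vertex d \<theta> n)"
  proof
    fix \<beta> assume \<beta>: "\<beta> \<in> preimage_level (chebyshev_poly d) (cos \<theta>) n"
    obtain \<phi> where \<phi>: "\<beta> = cos \<phi>"
      using cos_Arccos by metis
    have "cos (of_nat (d ^ n) * \<phi>) = cos \<theta>"
      using \<beta> unfolding preimage_level_def \<phi> mem_Collect_eq poly_chebyshev_funpow_cos .
    then obtain e k where e: "e \<in> {1, -1::int}"
      and k: "of_nat (d ^ n) * \<phi> = of_int e * \<theta> + 2 * of_real pi * of_int k"
      using cos_eq_iff_shift by blast
    have "of_int e * (of_nat (d ^ n) * \<phi>) = cos_lift \<theta> (e * k)"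
      unfolding k using e by (auto simp: algebra_simps)
    then have "cos_lift \<theta> (e * k) / of_nat (d ^ n) = of_int e * \<phi> + 2 * of_real pi * of_int 0"
      using assms by (auto simp: field_simps)
    then have "chebyshev_vertex d \<theta> n (e * k) = cos \<phi>"
      unfolding chebyshev_vertex_def by (simp only: cos_shift[OF e])
    then show "\<beta> \<in> range (chebyshev_vertex d \<theta> n)"
      unfolding \<phi> by (metis rangeI)
  qed
qed

text \<open>
  The two angles agree up to a symmetry of \<open>cos\<close>. The sign \<open>-1\<close> is impossible: after multiplication
  by \<open>d^n\<close> it would make \<open>\<theta>\<close> a multiple of \<open>\<pi>\<close>.
\<close>

lemma chebyshev_vertex_eq_iff:
  assumes "d > 0" and "sin \<theta> \<noteq> 0"
  shows "chebyshev_vertex d \<theta> n k = chebyshev_vertex d \<theta> n l \<longleftrightarrow> int (d ^ n) dvd k - l"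
proof
  let ?N = "int (d ^ n)"
  have N: "complex_of_nat (d ^ n) = of_int ?N" "complex_of_int ?N \<noteq> 0"
    using assms by simp_all
  {
    assume "chebyshev_vertex d \<theta> n k = chebyshev_vertex d \<theta> n l"
    then obtain e i where e: "e \<in> {1, -1::int}"
      and i: "cos_lift \<theta> k / of_int ?N = of_int e * (cos_lift \<theta> l / of_int ?N) + 2 * of_real pi * of_int i"
      unfolding chebyshev_vertex_def N(1) using cos_eq_iff_shift by blast
    have "of_int 1 * \<theta> + 2 * of_real pi * of_int k = of_int ?N * (cos_lift \<theta> k / of_int ?N)"
      using N(2) by simp
    also have "\<dots> = of_int e * \<theta> + 2 * of_real pi * of_int (e * l + ?N * i)"
    proof -
      have "M * (of_int e * (a / M) + 2 * of_real pi * of_int i) = of_int e * a + 2 * of_real pi * (M * of_int i)"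
        if "M \<noteq> 0" for M a :: complex
        using that by (simp add: field_simps)
      from this[OF N(2), of "cos_lift \<theta> l"] show ?thesis
        unfolding i of_int_add of_int_mult by (simp only: distrib_left mult.left_commute add.assoc)
    qed
    finally have eq: "of_int 1 * \<theta> + 2 * of_real pi * of_int k = of_int e * \<theta> + 2 * of_real pi * of_int (e * l + ?N * i)" .
    have "(1::int) \<in> {1, -1}"
      by simp
    from shift_unique[OF assms(2) this e eq] have "k - l = ?N * i"
      by auto
    then show "?N dvd k - l"
      by simp
  next
    assume "?N dvd k - l"
    then obtain i where "k - l = ?N * i"
      by (rule dvdE)
    then have "k = l + ?N * i"
      by simp
    then have "cos_lift \<theta> k / of_int ?N = of_int 1 * (cos_lift \<theta> l / of_int ?N) + 2 * of_real pi * of_int i"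
      using N(2) by (simp add: field_simps)
    then show "chebyshev_vertex d \<theta> n k = chebyshev_vertex d \<theta> n l"
      unfolding chebyshev_vertex_def N(1) by (simp only: cos_shift[of 1] insert_iff simp_thms)
  }
qed

lemma chebyshev_vertex_parent:
  assumes "d > 0"
  shows "poly (chebyshev_poly d) (chebyshev_vertex d \<theta> (Suc n) k) = chebyshev_vertex d \<theta> n k"
  unfolding chebyshev_vertex_def poly_chebyshev_cos using assms by simp

text \<open>
  If \<open>\<zeta>\<close> lifts \<open>\<gamma>\<close> through \<open>cos\<close>, then \<open>cos (\<zeta> / d^n)\<close> lifts \<open>\<gamma>\<close> through the \<open>n\<close>-th iterate.
  Conversely a lift \<open>\<eta>\<close> through the iterate avoids \<open>1\<close> and \<open>-1\<close>, because these are mapped into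
  \<open>{1, -1}\<close>. So \<open>\<eta>\<close> lifts through \<open>cos\<close>, and \<open>d^n\<close> times this lift is a lift of a loop homotopic to
  \<open>\<gamma>\<close>. Its end point is therefore known by homotopy lifting.
\<close>

lemma monodromy_action_vertex:
  assumes d: "d > 0" and \<theta>: "sin \<theta> \<noteq> 0"
    and \<gamma>: "\<gamma> \<in> loops_at (- {1, -1}) (cos \<theta>)" and kl: "cos_monodromy \<theta> \<gamma> k l"
  shows "monodromy_action (chebyshev_poly d) (cos \<theta>) n (path_class (- {1, -1}) \<gamma>) (chebyshev_vertex d \<theta> n k) =
         chebyshev_vertex d \<theta> n l"
proof -
  let ?f = "poly (chebyshev_poly d) :: complex \<Rightarrow> complex"
  let ?N = "complex_of_nat (d ^ n)"
  have N: "?N \<noteq> 0"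
    using d by simp
  obtain e where e: "e \<in> {1, -1::int}" and trans: "cos_transport \<gamma> (cos_lift \<theta> k) (of_int e * cos_lift \<theta> l)"
    using kl unfolding cos_monodromy_def by blast
  have vertex_l: "cos (of_int e * cos_lift \<theta> l / ?N) = chebyshev_vertex d \<theta> n l"
    unfolding chebyshev_vertex_def using cos_shift[OF e, of "cos_lift \<theta> l / ?N" 0] by simp
  have "(THE w. \<exists>\<gamma>'\<in>path_class (- {1, -1}) \<gamma>. \<exists>\<eta>. path \<eta> \<and> pathstart \<eta> = chebyshev_vertex d \<theta> n k \<and>
      pathfinish \<eta> = w \<and> (\<forall>t\<in>{0..1}. (?f ^^ n) (\<eta> t) = \<gamma>' t)) = chebyshev_vertex d \<theta> n l"
  proof (rule the_equality)
    obtain \<zeta> where \<zeta>: "path \<zeta>" "pathstart \<zeta> = cos_lift \<theta> k" "pathfinish \<zeta> = of_int e * cos_lift \<theta> l"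
        "\<And>t. t \<in> {0..1} \<Longrightarrow> cos (\<zeta> t) = \<gamma> t"
      using trans unfolding cos_transport_def by blast
    let ?\<eta> = "\<lambda>t. cos (\<zeta> t / ?N)"
    have "path ?\<eta>"
      using \<zeta>(1) N unfolding path_def by (intro continuous_intros) auto
    moreover have "pathstart ?\<eta> = chebyshev_vertex d \<theta> n k" "pathfinish ?\<eta> = chebyshev_vertex d \<theta> n l"
      using \<zeta>(2,3) vertex_l by (simp_all add: pathstart_def pathfinish_def chebyshev_vertex_def)
    moreover have "(?f ^^ n) (?\<eta> t) = \<gamma> t" if "t \<in> {0..1}" for t
      unfolding poly_chebyshev_funpow_cos using N \<zeta>(4)[OF that] by simp
    moreover have "\<gamma> \<in> path_class (- {1, -1}) \<gamma>"
      using loops_atD(5)[OF \<gamma>] unfolding path_class_def mem_Collect_eq .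
    ultimately show "\<exists>\<gamma>'\<in>path_class (- {1, -1}) \<gamma>. \<exists>\<eta>. path \<eta> \<and> pathstart \<eta> = chebyshev_vertex d \<theta> n k \<and>
        pathfinish \<eta> = chebyshev_vertex d \<theta> n l \<and> (\<forall>t\<in>{0..1}. (?f ^^ n) (\<eta> t) = \<gamma>' t)"
      by blast
  next
    fix w
    assume "\<exists>\<gamma>'\<in>path_class (- {1, -1}) \<gamma>. \<exists>\<eta>. path \<eta> \<and> pathstart \<eta> = chebyshev_vertex d \<theta> n k \<and>
        pathfinish \<eta> = w \<and> (\<forall>t\<in>{0..1}. (?f ^^ n) (\<eta> t) = \<gamma>' t)"
    then obtain \<gamma>' \<eta> where \<gamma>': "homotopic_paths (- {1, -1}) \<gamma> \<gamma>'"
      and \<eta>: "path \<eta>" "pathstart \<eta> = chebyshev_vertex d \<theta> n k" "pathfinish \<eta> = w"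
        "\<And>t. t \<in> {0..1} \<Longrightarrow> (?f ^^ n) (\<eta> t) = \<gamma>' t"
      unfolding path_class_def by blast
    have \<gamma>'_avoids: "\<gamma>' t \<notin> {1, -1}" if "t \<in> {0..1}" for t
      using homotopic_paths_imp_subset[OF \<gamma>'] that unfolding path_image_def by blast
    have "path_image \<eta> \<subseteq> - {1, -1}"
      unfolding path_image_def
    proof (rule image_subsetI)
      fix t :: real assume t: "t \<in> {0..1}"
      then show "\<eta> t \<in> - {1, -1}"
        using \<gamma>'_avoids[OF t] chebyshev_pm1[of "\<eta> t" n d] \<eta>(4)[OF t] by (metis ComplI)
    qed
    then obtain b where "cos_transport \<eta> (cos_lift \<theta> k / ?N) b"
      using cos_transport_exists[OF \<eta>(1)] \<eta>(2) unfolding chebyshev_vertex_def by blast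
    then obtain \<zeta> where \<zeta>: "path \<zeta>" "pathstart \<zeta> = cos_lift \<theta> k / ?N" "pathfinish \<zeta> = b"
        "\<And>t. t \<in> {0..1} \<Longrightarrow> cos (\<zeta> t) = \<eta> t"
      unfolding cos_transport_def by blast
    let ?\<zeta> = "\<lambda>t. ?N * \<zeta> t"
    have cos\<zeta>: "cos (?\<zeta> t) = \<gamma>' t" if "t \<in> {0..1}" for t
      using \<eta>(4)[OF that] \<zeta>(4)[OF that] poly_chebyshev_funpow_cos[of n d "\<zeta> t"] by simp
    have "path ?\<zeta>"
      using \<zeta>(1) unfolding path_def by (intro continuous_intros)
    moreover have "path_image ?\<zeta> \<subseteq> {z. sin z \<noteq> 0}"
      unfolding path_image_def
    proof (rule image_subsetI)
      fix t :: real assume t: "t \<in> {0..1}"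
      from \<gamma>'_avoids[OF t] show "?\<zeta> t \<in> {z. sin z \<noteq> 0}"
        unfolding cos\<zeta>[OF t, symmetric] by (simp only: sin_eq_0_iff_cos mem_Collect_eq not_False_eq_True)
    qed
    ultimately have "cos_transport \<gamma>' (cos_lift \<theta> k) (?N * b)"
      unfolding cos_transport_def using \<zeta>(2,3) cos\<zeta> N
      by (intro exI[of _ ?\<zeta>]) (simp add: pathstart_def pathfinish_def)
    from cos_transport_homotopic[OF \<gamma>' trans this] have "b = of_int e * cos_lift \<theta> l / ?N"
      using N by (simp add: field_simps)
    moreover have "w = cos b"
      using \<zeta>(3) \<zeta>(4)[of 1] \<eta>(3) by (simp add: pathfinish_def)
    ultimately show "w = chebyshev_vertex d \<theta> n l"
      using vertex_l by simp
  qed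
  moreover have "chebyshev_vertex d \<theta> n k \<in> preimage_level (chebyshev_poly d) (cos \<theta>) n"
    unfolding preimage_level_chebyshev[OF d] by simp
  ultimately show ?thesis
    unfolding monodromy_action_def by simp
qed

lemma eq_of_dvd_all_powers:
  assumes "d \<ge> (2::nat)" and "\<And>n. int (d ^ n) dvd a"
  shows "a = 0"
proof (rule ccontr)
  assume "a \<noteq> 0"
  obtain n where "nat \<bar>a\<bar> < d ^ n"
    using assms(1) by (metis less_exp power_mono zero_le order_less_le_trans)
  moreover have "\<bar>int (d ^ n)\<bar> \<le> \<bar>a\<bar>"
    using \<open>a \<noteq> 0\<close> assms(2) by (rule dvd_imp_le_int)
  ultimately show False
    by linarith
qed

lemma monodromy_action_deck_map:
  assumes "d > 0" and "sin \<theta> \<noteq> 0" and "A \<in> carrier (fundamental_group (- {1, -1}) (cos \<theta>))"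
  shows "monodromy_action (chebyshev_poly d) (cos \<theta>) n A (chebyshev_vertex d \<theta> n k) =
         chebyshev_vertex d \<theta> n (deck_map \<theta> A k)"
proof -
  obtain \<gamma> where \<gamma>: "\<gamma> \<in> loops_at (- {1, -1}) (cos \<theta>)" "A = path_class (- {1, -1}) \<gamma>"
    using assms(3) unfolding carrier_fundamental_group by blast
  show ?thesis
    unfolding \<gamma>(2) by (rule monodromy_action_vertex[OF assms(1,2) \<gamma>(1) deck_map_loop(2)[OF assms(2) \<gamma>(1)]])
qed

text \<open>
  A class acting trivially modulo all powers \<open>d^n\<close> acts trivially on the integers, so the quotient by
  the monodromy kernel is exactly the image of \<open>deck_map\<close>.
\<close>

lemma monodromy_kernel_chebyshev:
  assumes d: "d \<ge> 2" and \<theta>: "sin \<theta> \<noteq> 0"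
  shows "monodromy_kernel (chebyshev_poly d) (cos \<theta>) =
         kernel (fundamental_group (- {1, -1}) (cos \<theta>)) (BijGroup UNIV) (deck_map \<theta>)"
proof -
  have d0: "d > 0"
    using d by simp
  have "(\<forall>n. \<forall>\<beta>\<in>preimage_level (chebyshev_poly d) (cos \<theta>) n.
           monodromy_action (chebyshev_poly d) (cos \<theta>) n A \<beta> = \<beta>) \<longleftrightarrow> deck_map \<theta> A = (\<lambda>k. k)"
    if A: "A \<in> carrier (fundamental_group (- {1, -1}) (cos \<theta>))" for A
    unfolding preimage_level_chebyshev[OF d0] ball_simps monodromy_action_deck_map[OF d0 \<theta> A]
      chebyshev_vertex_eq_iff[OF d0 \<theta>] fun_eq_iff
    using eq_of_dvd_all_powers[OF d] by (metis dvd_0_right eq_iff_diff_eq_0)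
  then show ?thesis
    unfolding monodromy_kernel_def post_critical_complement_chebyshev[OF d] kernel_def
    by (auto simp: BijGroup_def restrict_def)
qed


section \<open>The iterated monodromy group\<close>

text \<open>
  The elements of the iterated monodromy group are cosets of the kernel of \<open>deck_map\<close>, on each of which
  \<open>deck_map\<close> is constant.
\<close>

lemma IMG_chebyshev_coset:
  assumes \<theta>: "sin \<theta> \<noteq> 0"
    and X: "X \<in> carrier (fundamental_group (- {1, -1}) (cos \<theta>) Mod
              kernel (fundamental_group (- {1, -1}) (cos \<theta>)) (BijGroup UNIV) (deck_map \<theta>))"
  obtains A where "A \<in> X" and "X \<subseteq> carrier (fundamental_group (- {1, -1}) (cos \<theta>))"
    and "deck_map \<theta> ` X = {deck_map \<theta> A}"
proof -
  let ?P = "fundamental_group (- {1, -1}) (cos \<theta>)"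
  interpret group_hom ?P "BijGroup UNIV" "deck_map \<theta>"
    by (rule deck_map_hom(1)[OF \<theta>])
  obtain A where A: "A \<in> carrier ?P" "X = kernel ?P (BijGroup UNIV) (deck_map \<theta>) #>\<^bsub>?P\<^esub> A"
    using X unfolding carrier_FactGroup by blast
  have "A \<in> X"
    unfolding A(2) using A(1) subgroup_kernel by (rule G.rcos_self)
  moreover have "X \<subseteq> carrier ?P"
    unfolding A(2) using A(1) by (intro G.r_coset_subset_G) (auto simp: kernel_def)
  moreover have "deck_map \<theta> B = deck_map \<theta> A" if "B \<in> X" for B
    using that A(1) unfolding A(2) r_coset_def kernel_def by auto
  ultimately show thesis
    using that by blast
qed

text \<open>
  By the first isomorphism theorem \<open>deck_map\<close> descends to a faithful dihedral action of the quotient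
  on the integers, and this action determines the action on every level.
\<close>

lemma dihedral_tree_action_IMG_chebyshev:
  assumes d: "d \<ge> 2" and \<theta>: "sin \<theta> \<noteq> 0"
  shows "dihedral_tree_action (IMG (chebyshev_poly d) (cos \<theta>)) d
           (preimage_level (chebyshev_poly d) (cos \<theta>)) (preimage_parent (chebyshev_poly d))
           (IMG_action (chebyshev_poly d) (cos \<theta>))
           (chebyshev_vertex d \<theta>) (\<lambda>X. the_elem (deck_map \<theta> ` X))"
proof -
  let ?f = "chebyshev_poly d :: complex poly" and ?P = "fundamental_group (- {1, -1}) (cos \<theta>)"
  let ?h = "\<lambda>X. the_elem (deck_map \<theta> ` X)"
  interpret group_hom ?P "BijGroup UNIV" "deck_map \<theta>"
    by (rule deck_map_hom(1)[OF \<theta>])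
  have d0: "d > 0"
    using d by simp
  let ?K = "kernel ?P (BijGroup UNIV) (deck_map \<theta>)"
  have IMG: "IMG ?f (cos \<theta>) = ?P Mod ?K"
    unfolding IMG_def post_critical_complement_chebyshev[OF d] monodromy_kernel_chebyshev[OF d \<theta>] ..
  have image: "?h ` carrier (?P Mod ?K) = dihedral_maps"
  proof -
    have "?h ` carrier (?P Mod ?K) = deck_map \<theta> ` carrier ?P"
    proof -
      have "?h (?K #>\<^bsub>?P\<^esub> A) = deck_map \<theta> A" if A: "A \<in> carrier ?P" for A
      proof -
        have "?K #>\<^bsub>?P\<^esub> A \<in> carrier (?P Mod ?K)"
          using A unfolding carrier_FactGroup by blast
        then obtain B where B: "deck_map \<theta> ` (?K #>\<^bsub>?P\<^esub> A) = {deck_map \<theta> B}"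
          by (rule IMG_chebyshev_coset[OF \<theta>])
        moreover have "A \<in> ?K #>\<^bsub>?P\<^esub> A"
          using A subgroup_kernel by (rule G.rcos_self)
        ultimately have "deck_map \<theta> A = deck_map \<theta> B"
          by blast
        then show ?thesis
          unfolding B by simp
      qed
      then show ?thesis
        unfolding carrier_FactGroup image_image by (intro image_cong refl)
    qed
    then show ?thesis
      unfolding deck_map_hom(2)[OF \<theta>] .
  qed
  have action: "IMG_action ?f (cos \<theta>) n X \<in> extensional (preimage_level ?f (cos \<theta>) n)"
      "IMG_action ?f (cos \<theta>) n X (chebyshev_vertex d \<theta> n k) = chebyshev_vertex d \<theta> n (?h X k)"
    if X: "X \<in> carrier (?P Mod ?K)" for n X k
  proof -
    obtain A where A: "A \<in> X" "X \<subseteq> carrier ?P" and deck: "deck_map \<theta> ` X = {deck_map \<theta> A}"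
      using X by (rule IMG_chebyshev_coset[OF \<theta>])
    have ext: "monodromy_action ?f (cos \<theta>) n B \<in> extensional (preimage_level ?f (cos \<theta>) n)" for B
      unfolding monodromy_action_def by simp
    have "monodromy_action ?f (cos \<theta>) n B = monodromy_action ?f (cos \<theta>) n A" if B: "B \<in> X" for B
    proof (rule extensionalityI[OF ext ext])
      fix \<beta> assume "\<beta> \<in> preimage_level ?f (cos \<theta>) n"
      then obtain l where "\<beta> = chebyshev_vertex d \<theta> n l"
        unfolding preimage_level_chebyshev[OF d0] by blast
      moreover have "deck_map \<theta> B = deck_map \<theta> A"
        using deck B by blast
      ultimately show "monodromy_action ?f (cos \<theta>) n B \<beta> = monodromy_action ?f (cos \<theta>) n A \<beta>"
        using monodromy_action_deck_map[OF d0 \<theta>] A B by (metis subsetD)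
    qed
    then have "monodromy_action ?f (cos \<theta>) n ` X = {monodromy_action ?f (cos \<theta>) n A}"
      using A(1) by blast
    then have eq: "IMG_action ?f (cos \<theta>) n X = monodromy_action ?f (cos \<theta>) n A"
      unfolding IMG_action_def by simp
    show "IMG_action ?f (cos \<theta>) n X \<in> extensional (preimage_level ?f (cos \<theta>) n)"
      unfolding eq by (rule ext)
    show "IMG_action ?f (cos \<theta>) n X (chebyshev_vertex d \<theta> n k) = chebyshev_vertex d \<theta> n (?h X k)"
      unfolding eq deck the_elem_eq using A by (intro monodromy_action_deck_map d0 \<theta>) blast
  qed
  have closed: "?h X \<in> Bij UNIV" if "X \<in> carrier (?P Mod ?K)" for X
    using that image dihedral_maps_bij by blast
  have mult: "?h (X \<otimes>\<^bsub>?P Mod ?K\<^esub> Y) = ?h X \<circ> ?h Y"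
    if "X \<in> carrier (?P Mod ?K)" "Y \<in> carrier (?P Mod ?K)" for X Y
  proof -
    have "?h (X \<otimes>\<^bsub>?P Mod ?K\<^esub> Y) = ?h X \<otimes>\<^bsub>BijGroup UNIV\<^esub> ?h Y"
      using that by (rule Group.hom_mult[OF FactGroup_hom])
    then show ?thesis
      using closed[OF that(1)] closed[OF that(2)] by (simp add: BijGroup_def compose_def o_def restrict_def)
  qed
  show ?thesis
    unfolding IMG
  proof (intro dihedral_tree_action.intro dihedral_tree_action_axioms.intro)
    show "group (?P Mod ?K)"
      by (rule normal.factorgroup_is_group[OF normal_kernel])
    show "inj_on ?h (carrier (?P Mod ?K))"
      by (rule FactGroup_inj_on)
    show "preimage_parent ?f n (chebyshev_vertex d \<theta> (Suc n) k) = chebyshev_vertex d \<theta> n k" for n k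
      unfolding preimage_parent_def by (rule chebyshev_vertex_parent[OF d0])
  qed (fact d image mult preimage_level_chebyshev[OF d0] chebyshev_vertex_eq_iff[OF d0 \<theta>] action)+
qed

theorem theorem1p8:
  fixes d :: nat and s :: complex and x :: "nat \<Rightarrow> complex"
  assumes "d \<ge> 2"
    and "s \<in> post_critical_complement (chebyshev_poly d)"
    and "x \<in> tree_paths (preimage_level (chebyshev_poly d) s) (preimage_parent (chebyshev_poly d))"
  shows "stable_with_discriminant d
           (IMG (chebyshev_poly d) s)
           (preimage_level (chebyshev_poly d) s)
           (preimage_parent (chebyshev_poly d))
           (IMG_action (chebyshev_poly d) s)
           x
           (integer_mod_group 2)"
proof -
  obtain \<theta> where s: "s = cos \<theta>"
    using cos_Arccos by metis
  have "cos \<theta> \<notin> {1, -1}"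
    using assms(2) unfolding s post_critical_complement_chebyshev[OF assms(1)] by (rule ComplD)
  then have "sin \<theta> \<noteq> 0"
    by (simp only: sin_eq_0_iff_cos not_False_eq_True)
  from dihedral_tree_action_IMG_chebyshev[OF assms(1) this] assms(3)
  show ?thesis
    unfolding s
    by (intro dihedral_tree_path.stable_with_discriminant_2 dihedral_tree_path.intro dihedral_tree_path_axioms.intro)
qed

end
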